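(* Let $\rho=\tfrac12+\tfrac{\sqrt{-3}}{2}$. The smallest value in $\mathcal{M}_\rho$ is $\sqrt{3}$, and it is attained by the billiard $\mathcal{C}_0$ induced by the geodesic $\langle 0,\infty\rangle$ (the imaginary axis), i.e. $\lambda_\rho(\mathcal{C}_0)=\sqrt3$ and $\lambda_\rho(\mathcal{B})\ge\sqrt3$ for every modular billiard $\mathcal{B}$. Moreover $\sqrt{3}$ is a limit point of $\mathcal{M}_\rho$.
   Context: Let $\mathbb{H}$ be the upper half-plane with hyperbolic metric $ds=|dz|/y$. The group $\Gamma=\mathrm{PGL}(2,\mathbb{Z})$ acts on $\mathbb{H}$: $M=\pm\begin{pmatrix}a&b\\c&d\end{pmatrix}$ with $\det M=1$ acts by $z\mapsto \frac{az+b}{cz+d}$, and with $\det M=-1$ by $z\mapsto \frac{a\bar z+b}{c\bar z+d}$. Let $\mathcal{T}=\{z\in\mathbb{H}: 0\le \mathrm{Re}\,z\le \tfrac12,\ |z|\ge 1\}$, a fundamental domain for $\Gamma$ (a triangle whose sides are fixed by the reflections generating $\Gamma$). For distinct $\alpha,\beta\in\mathbb{R}\cup\{\infty\}$, $\langle\alpha,\beta\rangle$ denotes the oriented geodesic from $\alpha$ to $\beta$. For an oriented geodesic $S$, the modular billiard $\mathcal{B}$ induced by $S$ is the set of distinct directed geodesic segments in $\mathcal{T}$ of the orbit $\Gamma S$ (i.e. the intersections with $\mathcal{T}$ of the oriented geodesics $gS$, $g\in\Gamma$); geodesics in the same $\Gamma$-orbit induce the same billiard. For $z\in\mathcal{T}$,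 $\delta_z(\mathcal{B})$ is the infimum of the hyperbolic distance between points of $\mathcal{B}$ and $z$, $\lambda_z(\mathcal{B})=(\sinh\delta_z(\mathcal{B}))^{-1}$, and $\mathcal{M}_z=\{\lambda_z(\mathcal{B}):\mathcal{B}\text{ a modular billiard}\}$. *)

theory Defs
  imports "HOL-Analysis.Analysis"
begin

definition upper_half_plane :: "complex set" where
  "upper_half_plane = {z. Im z > 0}"

text \<open>
  The distance of the Riemannian metric \<open>ds = |dz| / y\<close>: the infimum of the lengths of the
  piecewise continuously differentiable curves in the half-plane. A \<^const>\<open>valid_path\<close> may have
  a derivative that is unbounded near a breakpoint, hence infinite length; requiring
  \<^const>\<open>has_integral\<close> excludes these curves, whereas \<^const>\<open>integral\<close> would give
  them length \<open>0\<close>.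
\<close>

definition hyp_dist :: "complex \<Rightarrow> complex \<Rightarrow> real" where
  "hyp_dist z w = Inf {l. \<exists>\<gamma>. valid_path \<gamma> \<and> path_image \<gamma> \<subseteq> upper_half_plane \<and>
      pathstart \<gamma> = z \<and> pathfinish \<gamma> = w \<and>
      ((\<lambda>t. cmod (vector_derivative \<gamma> (at t)) / Im (\<gamma> t)) has_integral l) {0..1}}"

text \<open>
  The group \<open>PGL(2,\<int>)\<close> enters only through its action, so its elements are represented by
  integer matrices of determinant \<open>1\<close> or \<open>-1\<close>; both representatives \<open>M\<close> and \<open>-M\<close> act
  in the same way.
\<close>

definition GL2Z :: "(int ^ 2 ^ 2) set" where
  "GL2Z = {M. det M = 1 \<or> det M = -1}"

definition act :: "int ^ 2 ^ 2 \<Rightarrow> complex \<Rightarrow> complex" where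
  "act M z = (let w = (if det M = 1 then z else cnj z) in
     (of_int (M $ 1 $ 1) * w + of_int (M $ 1 $ 2)) / (of_int (M $ 2 $ 1) * w + of_int (M $ 2 $ 2)))"

lemma act_uminus: "act (- M) z = act M z"
proof -
  have "(- a * w + - b) / (- c * w + - d) = (a * w + b) / (c * w + d)" for a b c d w :: complex
    using minus_divide_divide[of "a * w + b" "c * w + d"] by (simp add: algebra_simps)
  then show ?thesis
    by (simp add: act_def Let_def det_2)
qed

definition fund_triangle :: "complex set" where
  "fund_triangle = {z \<in> upper_half_plane. 0 \<le> Re z \<and> Re z \<le> 1/2 \<and> cmod z \<ge> 1}"

datatype boundary_point = Fin real | Infty

text \<open>
  A directed curve without self-intersections is encoded as the relation
  ``\<open>p\<close> is on the curve, \<open>q\<close> is on the curve, and \<open>p\<close> equals \<open>q\<close> or is passed before \<open>q\<close>'';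
  its underlying point set is the \<^const>\<open>Field\<close> of the relation. A semicircle is traversed in the
  direction of increasing real part precisely if it starts at its left endpoint.
\<close>

fun geodesic :: "boundary_point \<Rightarrow> boundary_point \<Rightarrow> complex rel" where
  "geodesic (Fin a) (Fin b) = {(p, q). p \<in> upper_half_plane \<and> q \<in> upper_half_plane \<and>
     cmod (p - of_real ((a + b) / 2)) = \<bar>b - a\<bar> / 2 \<and>
     cmod (q - of_real ((a + b) / 2)) = \<bar>b - a\<bar> / 2 \<and>
     (if a < b then Re p \<le> Re q else Re q \<le> Re p)}"
| "geodesic (Fin a) Infty = {(p, q). p \<in> upper_half_plane \<and> q \<in> upper_half_plane \<and>
     Re p = a \<and> Re q = a \<and> Im p \<le> Im q}"
| "geodesic Infty (Fin b) = {(p, q). p \<in> upper_half_plane \<and> q \<in> upper_half_plane \<and>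
     Re p = b \<and> Re q = b \<and> Im q \<le> Im p}"
| "geodesic Infty Infty = {}"

definition oriented_geodesics :: "complex rel set" where
  "oriented_geodesics = {geodesic \<alpha> \<beta> | \<alpha> \<beta>. \<alpha> \<noteq> \<beta>}"

definition orbit :: "complex rel \<Rightarrow> complex rel set" where
  "orbit S = {map_prod (act M) (act M) ` S | M. M \<in> GL2Z}"

definition billiard :: "complex rel \<Rightarrow> complex rel set" where
  "billiard S = {Restr G fund_triangle | G. G \<in> orbit S} - {{}}"

definition modular_billiards :: "complex rel set set" where
  "modular_billiards = billiard ` oriented_geodesics"

definition billiard_points :: "complex rel set \<Rightarrow> complex set" where
  "billiard_points B = (\<Union>s\<in>B. Field s)"

definition billiard_dist :: "complex \<Rightarrow> complex rel set \<Rightarrow> real" where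
  "billiard_dist z B = (INF p\<in>billiard_points B. hyp_dist p z)"

text \<open>Extended real values, so that a billiard at distance \<open>0\<close> has the value \<open>\<infinity>\<close>.\<close>

definition billiard_value :: "complex \<Rightarrow> complex rel set \<Rightarrow> ereal" where
  "billiard_value z B = inverse (ereal (sinh (billiard_dist z B)))"

definition value_set :: "complex \<Rightarrow> ereal set" where
  "value_set z = billiard_value z ` modular_billiards"

definition rho :: complex where
  "rho = Complex (1/2) (sqrt 3 / 2)"

definition C0 :: "complex rel set" where
  "C0 = billiard (geodesic (Fin 0) Infty)"

end

theory Submission
  imports Defs "HOL-Complex_Analysis.Contour_Integration" "HOL-Library.Quadratic_Discriminant"
begin

text \<open>
  Write \<open>Q(z) = (|z|\<^sup>2 - Re z + 1) / Im z\<close>, so that \<open>cosh d(z, \<rho>) = Q(z) / \<surd>3\<close> and the value \<open>\<surd>3\<close>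
  corresponds to \<open>Q = 2\<close>. For \<open>M\<close> in the group, \<open>Q(M z) = (A |z|\<^sup>2 + B Re z + C) / Im z\<close> with
  integers \<open>4AC - B\<^sup>2 = 3\<close>. Points of \<open>\<T>\<close> minimise \<open>Q\<close> in their orbits, so distances may be measured
  on the whole orbit of a geodesic instead of its part in \<open>\<T>\<close>.

  On the imaginary axis, \<open>Q(M z)\<^sup>2 \<ge> 4AC \<ge> 4\<close>, with equality at \<open>\<i>\<close>. Conversely every orbit of
  geodesics has a point with \<open>Q \<le> 2\<close>: this set is the Euclidean disc of radius \<open>1/2\<close> around \<open>1/2 + \<i>\<close>,
  its translates cover the line \<open>Im z = 1\<close>, and the points of \<open>\<T>\<close> outside of the disc lie
  above this line, so a geodesic through such a point meets the line. Finally the geodesic \<open>\<langle>1/N, \<infinity>\<rangle>\<close> has the value \<open>\<surd>3 N / (N - 2)\<close>,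
  because \<open>|2A + BN| \<ge> N - 2\<close> for all \<open>A\<close>, \<open>B\<close> as above.
\<close>

section \<open>The hyperbolic distance\<close>

lemma hyp_lengths_nonneg:
  assumes "((\<lambda>t. cmod (vector_derivative \<gamma> (at t)) / Im (\<gamma> t)) has_integral l) {0..1}"
    and "path_image \<gamma> \<subseteq> upper_half_plane"
  shows "0 \<le> l"
proof (rule has_integral_nonneg[OF assms(1)])
  fix t :: real assume "t \<in> {0..1}"
  then have "\<gamma> t \<in> upper_half_plane" using assms(2) by (auto simp: path_image_def)
  then have "Im (\<gamma> t) > 0" by (simp add: upper_half_plane_def)
  then show "0 \<le> cmod (vector_derivative \<gamma> (at t)) / Im (\<gamma> t)" by simp
qed

lemma hyp_dist_le:
  assumes "valid_path \<gamma>" "path_image \<gamma> \<subseteq> upper_half_plane" "pathstart \<gamma> = z" "pathfinish \<gamma> = w"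
    and "((\<lambda>t. cmod (vector_derivative \<gamma> (at t)) / Im (\<gamma> t)) has_integral l) {0..1}"
  shows "hyp_dist z w \<le> l"
  unfolding hyp_dist_def
proof (rule cInf_lower)
  show "bdd_below {l. \<exists>\<gamma>. valid_path \<gamma> \<and> path_image \<gamma> \<subseteq> upper_half_plane \<and>
      pathstart \<gamma> = z \<and> pathfinish \<gamma> = w \<and>
      ((\<lambda>t. cmod (vector_derivative \<gamma> (at t)) / Im (\<gamma> t)) has_integral l) {0..1}}"
    by (rule bdd_belowI[of _ 0]) (auto intro: hyp_lengths_nonneg)
qed (use assms in blast)

text \<open>A calibration bound: the increment of \<open>f\<close> is the contour integral of
  \<open>f'\<close>, whose integrand is dominated pointwise by the hyperbolic line element.\<close>

lemma hyp_length_ge_primitive: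
  assumes f: "\<And>\<zeta>. \<zeta> \<in> upper_half_plane \<Longrightarrow> (f has_field_derivative f' \<zeta>) (at \<zeta>)"
    and f': "\<And>\<zeta>. \<zeta> \<in> upper_half_plane \<Longrightarrow> cmod (f' \<zeta>) \<le> 1 / Im \<zeta>"
    and \<gamma>: "valid_path \<gamma>" "path_image \<gamma> \<subseteq> upper_half_plane"
    and l: "((\<lambda>t. cmod (vector_derivative \<gamma> (at t)) / Im (\<gamma> t)) has_integral l) {0..1}"
  shows "cmod (f (pathfinish \<gamma>) - f (pathstart \<gamma>)) \<le> l"
proof -
  have "(f' has_contour_integral (f (pathfinish \<gamma>) - f (pathstart \<gamma>))) \<gamma>"
    by (rule contour_integral_primitive[OF _ \<gamma>]) (auto intro: has_field_derivative_at_within f)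
  then have i: "((\<lambda>t. f' (\<gamma> t) * vector_derivative \<gamma> (at t)) has_integral
      (f (pathfinish \<gamma>) - f (pathstart \<gamma>))) {0..1}"
    by (simp add: has_contour_integral)
  have "norm (integral {0..1} (\<lambda>t. f' (\<gamma> t) * vector_derivative \<gamma> (at t))) \<le>
      integral {0..1} (\<lambda>t. cmod (vector_derivative \<gamma> (at t)) / Im (\<gamma> t))"
  proof (rule integral_norm_bound_integral)
    fix t :: real assume "t \<in> {0..1}"
    then have "\<gamma> t \<in> upper_half_plane" using \<gamma>(2) by (auto simp: path_image_def)
    from mult_right_mono[OF f'[OF this], of "cmod (vector_derivative \<gamma> (at t))"]
    show "norm (f' (\<gamma> t) * vector_derivative \<gamma> (at t)) \<le> cmod (vector_derivative \<gamma> (at t)) / Im (\<gamma> t)"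
      by (simp add: norm_mult)
  qed (use i l in \<open>auto simp: has_integral_integrable\<close>)
  then show ?thesis using i l by (simp add: integral_unique)
qed

text \<open>\<open>Re f\<close> is 1-Lipschitz for the hyperbolic metric and restricts to the arc length on \<open>\<gamma>\<close>, so \<open>\<gamma>\<close> is
  length minimising.\<close>

lemma hyp_dist_unit_speed:
  assumes \<gamma>: "\<And>s. (\<gamma> has_vector_derivative \<gamma>' s) (at s)" "continuous_on UNIV \<gamma>'"
    and im: "\<And>s. \<gamma> s \<in> upper_half_plane" "\<And>s. cmod (\<gamma>' s) = Im (\<gamma> s)"
    and f: "\<And>\<zeta>. \<zeta> \<in> upper_half_plane \<Longrightarrow> (f has_field_derivative f' \<zeta>) (at \<zeta>)"
    and f': "\<And>\<zeta>. \<zeta> \<in> upper_half_plane \<Longrightarrow> cmod (f' \<zeta>) \<le> 1 / Im \<zeta>"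
    and Re: "\<And>s. Re (f (\<gamma> s)) = s"
  shows "hyp_dist (\<gamma> s) (\<gamma> t) = \<bar>t - s\<bar>"
proof (rule antisym)
  \<comment> \<open>The affine reparametrisation runs over the unit interval from \<open>s\<close>
    to \<open>t\<close>, whichever of the two is larger.\<close>
  define g where "g = (\<lambda>u. \<gamma> (s + u * (t - s)))"
  define D where "D = (\<lambda>u. (t - s) *\<^sub>R \<gamma>' (s + u * (t - s)))"
  have g': "(g has_vector_derivative D u) (at u)" for u
  proof -
    have "((\<gamma> \<circ> (\<lambda>u. s + u * (t - s))) has_vector_derivative (t - s) *\<^sub>R \<gamma>' (s + u * (t - s))) (at u)"
      by (rule vector_diff_chain_at) (auto intro!: derivative_eq_intros \<gamma>)
    then show ?thesis by (simp add: g_def D_def o_def)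
  qed
  have "continuous_on {0..1} D"
    unfolding D_def by (intro continuous_intros continuous_on_compose2[OF \<gamma>(2)]) auto
  then have "g C1_differentiable_on {0..1}"
    unfolding C1_differentiable_on_def using g' by (intro exI[of _ D]) simp
  then have vp: "valid_path g"
    unfolding valid_path_def by (rule C1_differentiable_imp_piecewise)
  have pi: "path_image g \<subseteq> upper_half_plane" by (auto simp: path_image_def g_def im)
  have ends: "pathstart g = \<gamma> s" "pathfinish g = \<gamma> t" by (auto simp: pathstart_def pathfinish_def g_def)
  have "cmod (vector_derivative g (at u)) / Im (g u) = \<bar>t - s\<bar>" for u
  proof -
    have "vector_derivative g (at u) = D u"
      using g' by (rule vector_derivative_at)
    moreover have "Im (g u) > 0" using im by (auto simp: g_def upper_half_plane_def)
    ultimately show ?thesis by (simp add: im g_def D_def)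
  qed
  then have len: "((\<lambda>u. cmod (vector_derivative g (at u)) / Im (g u)) has_integral \<bar>t - s\<bar>) {0..1}"
    using has_integral_const_real[of "\<bar>t - s\<bar>" 0 1] by simp
  show "hyp_dist (\<gamma> s) (\<gamma> t) \<le> \<bar>t - s\<bar>"
    by (rule hyp_dist_le[OF vp pi ends len])
  show "\<bar>t - s\<bar> \<le> hyp_dist (\<gamma> s) (\<gamma> t)"
    unfolding hyp_dist_def
  proof (rule cInf_greatest)
    show "{l. \<exists>\<gamma>'. valid_path \<gamma>' \<and> path_image \<gamma>' \<subseteq> upper_half_plane \<and>
      pathstart \<gamma>' = \<gamma> s \<and> pathfinish \<gamma>' = \<gamma> t \<and>
      ((\<lambda>t. cmod (vector_derivative \<gamma>' (at t)) / Im (\<gamma>' t)) has_integral l) {0..1}} \<noteq> {}"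
      by (intro notI, drule equalityD1, drule subsetD[of _ _ "\<bar>t - s\<bar>"])
        (simp_all, intro exI[of _ g] conjI vp pi ends len)
  next
    fix l assume "l \<in> {l. \<exists>\<gamma>'. valid_path \<gamma>' \<and> path_image \<gamma>' \<subseteq> upper_half_plane \<and>
      pathstart \<gamma>' = \<gamma> s \<and> pathfinish \<gamma>' = \<gamma> t \<and>
      ((\<lambda>t. cmod (vector_derivative \<gamma>' (at t)) / Im (\<gamma>' t)) has_integral l) {0..1}}"
    then obtain \<eta> where \<eta>: "valid_path \<eta>" "path_image \<eta> \<subseteq> upper_half_plane"
      and ends: "pathstart \<eta> = \<gamma> s" "pathfinish \<eta> = \<gamma> t"
      and l: "((\<lambda>t. cmod (vector_derivative \<eta> (at t)) / Im (\<eta> t)) has_integral l) {0..1}"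
      by auto
    have "cmod (f (\<gamma> t) - f (\<gamma> s)) \<le> l"
      using hyp_length_ge_primitive[of f f', OF f f' \<eta> l] by (simp add: ends)
    moreover have "\<bar>Re (f (\<gamma> t) - f (\<gamma> s))\<bar> \<le> cmod (f (\<gamma> t) - f (\<gamma> s))" by (rule abs_Re_le_cmod)
    ultimately show "\<bar>t - s\<bar> \<le> l" by (simp add: Re)
  qed
qed

section \<open>Vertical lines and semicircles as shortest curves; the distance formula\<close>

lemma has_field_derivative_Ln_diff_real:
  assumes "Im \<zeta> > 0"
  shows "((\<lambda>\<zeta>. Ln (\<zeta> - of_real a)) has_field_derivative 1 / (\<zeta> - of_real a)) (at \<zeta>)"
proof -
  have "\<zeta> - of_real a \<notin> \<real>\<^sub>\<le>\<^sub>0" using assms by (auto simp: complex_nonpos_Reals_iff)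
  moreover have "((\<lambda>\<zeta>. \<zeta> - of_real a) has_field_derivative 1) (at \<zeta>)"
    by (auto intro!: derivative_eq_intros)
  ultimately have "((\<lambda>\<zeta>. Ln (\<zeta> - of_real a)) has_field_derivative inverse (\<zeta> - of_real a) * 1) (at \<zeta>)"
    by (intro DERIV_chain2[OF has_field_derivative_Ln])
  then show ?thesis by (simp add: inverse_eq_divide)
qed

text \<open>The real part of \<open>Ln (\<zeta> - a)\<close> is the logarithm of the Euclidean
  distance to the endpoint \<open>a\<close>, which on the vertical line above \<open>a\<close> is
  exactly the parameter.\<close>

lemma hyp_dist_vertical:
  "hyp_dist (Complex a (exp s)) (Complex a (exp t)) = \<bar>t - s\<bar>"
proof (rule hyp_dist_unit_speed[where \<gamma> = "\<lambda>s. Complex a (exp s)" and \<gamma>' = "\<lambda>s. Complex 0 (exp s)"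
      and f = "\<lambda>\<zeta>. Ln (\<zeta> - of_real a)" and f' = "\<lambda>\<zeta>. 1 / (\<zeta> - of_real a)"])
  show "((\<lambda>s. Complex a (exp s)) has_vector_derivative Complex 0 (exp s)) (at s)" for s
    by (auto simp: has_vector_derivative_complex_iff intro!: derivative_eq_intros)
  show "continuous_on UNIV (\<lambda>s. Complex 0 (exp s))"
    by (intro continuous_intros)
  fix \<zeta> assume \<zeta>: "\<zeta> \<in> upper_half_plane"
  then have im: "Im \<zeta> > 0" by (simp add: upper_half_plane_def)
  then show "((\<lambda>\<zeta>. Ln (\<zeta> - of_real a)) has_field_derivative 1 / (\<zeta> - of_real a)) (at \<zeta>)"
    by (rule has_field_derivative_Ln_diff_real)
  have "Im \<zeta> \<le> cmod (\<zeta> - of_real a)" using abs_Im_le_cmod[of "\<zeta> - of_real a"] by simp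
  then show "cmod (1 / (\<zeta> - of_real a)) \<le> 1 / Im \<zeta>" using im by (simp add: norm_divide frac_le)
next
  fix s show "Re (Ln (Complex a (exp s) - of_real a)) = s"
  proof -
    have e: "Complex a (exp s) - of_real a = Complex 0 (exp s)" by (simp add: complex_eq_iff)
    have "Complex 0 (exp s) \<noteq> 0" by (simp add: complex_eq_iff)
    then show ?thesis unfolding e by (simp add: Re_Ln cmod_def)
  qed
qed (auto simp: upper_half_plane_def cmod_def)

lemma sech_tanh_sq: "(1 / cosh s)\<^sup>2 + (tanh s)\<^sup>2 = (1::real)"
proof -
  have p: "(cosh s)\<^sup>2 \<noteq> 0" using cosh_real_pos[of s] by (metis less_irrefl power_eq_0_iff)
  have "(1 / cosh s)\<^sup>2 + (tanh s)\<^sup>2 = (1 + (sinh s)\<^sup>2) / (cosh s)\<^sup>2"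
    by (simp only: tanh_def power_divide add_divide_distrib power_one)
  also have "1 + (sinh s)\<^sup>2 = (cosh s)\<^sup>2" by (simp only: cosh_square_eq add.commute)
  also have "(cosh s)\<^sup>2 / (cosh s)\<^sup>2 = 1" using p by (rule divide_self)
  finally show ?thesis .
qed

text \<open>The primitive is a branch of the logarithm of a Moebius map sending the endpoints
  \<open>c - r\<close> and \<open>c + r\<close> to 0 and infinity, so this is the vertical case
  transported to the semicircle.\<close>

lemma hyp_dist_semicircle:
  fixes c r :: real
  assumes r: "r > 0"
  defines "\<gamma> \<equiv> \<lambda>s. Complex (c + r * tanh s) (r / cosh s)"
  shows "hyp_dist (\<gamma> s) (\<gamma> t) = \<bar>t - s\<bar>"
proof (rule hyp_dist_unit_speed[where \<gamma> = \<gamma> and \<gamma>' = "\<lambda>s. Complex (r * (1 - (tanh s)\<^sup>2)) (- r * tanh s / cosh s)"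
      and f = "\<lambda>\<zeta>. Ln (\<zeta> - of_real (c - r)) - Ln (\<zeta> - of_real (c + r))"
      and f' = "\<lambda>\<zeta>. 1 / (\<zeta> - of_real (c - r)) - 1 / (\<zeta> - of_real (c + r))"])
  have pos: "cosh s > 0" for s :: real by (rule cosh_real_pos)
  have nz: "cosh s \<noteq> 0" for s :: real using pos[of s] by linarith
  show "(\<gamma> has_vector_derivative Complex (r * (1 - (tanh s)\<^sup>2)) (- r * tanh s / cosh s)) (at s)" for s
    unfolding \<gamma>_def has_vector_derivative_complex_iff
    using nz by (auto simp: tanh_def power2_eq_square field_simps intro!: derivative_eq_intros)
  show "continuous_on UNIV (\<lambda>s. Complex (r * (1 - (tanh s)\<^sup>2)) (- r * tanh s / cosh s))"
    by (intro continuous_intros) (auto simp: nz)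
  show "\<gamma> s \<in> upper_half_plane" for s using r pos[of s] by (simp add: \<gamma>_def upper_half_plane_def)
  show "cmod (Complex (r * (1 - (tanh s)\<^sup>2)) (- r * tanh s / cosh s)) = Im (\<gamma> s)" for s
  proof -
    define u where "u = 1 / cosh s"
    have u: "1 - (tanh s)\<^sup>2 = u\<^sup>2" using sech_tanh_sq[of s] by (simp add: u_def)
    have "(r * u\<^sup>2)\<^sup>2 + (r * tanh s * u)\<^sup>2 = (r * u)\<^sup>2 * (u\<^sup>2 + (tanh s)\<^sup>2)"
      by (simp add: power2_eq_square algebra_simps)
    also have "\<dots> = (r * u)\<^sup>2" using u by simp
    finally have "sqrt ((r * u\<^sup>2)\<^sup>2 + (r * tanh s * u)\<^sup>2) = r * u" using r pos[of s] by (simp add: u_def)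
    moreover have "- r * tanh s / cosh s = - (r * tanh s * u)" "r / cosh s = r * u" by (simp_all add: u_def)
    ultimately show ?thesis by (simp add: \<gamma>_def u cmod_def)
  qed
  fix \<zeta> assume \<zeta>: "\<zeta> \<in> upper_half_plane"
  then have im: "Im \<zeta> > 0" by (simp add: upper_half_plane_def)
  then show "((\<lambda>\<zeta>. Ln (\<zeta> - of_real (c - r)) - Ln (\<zeta> - of_real (c + r))) has_field_derivative
      1 / (\<zeta> - of_real (c - r)) - 1 / (\<zeta> - of_real (c + r))) (at \<zeta>)"
    by (intro DERIV_diff has_field_derivative_Ln_diff_real)
  define p q where "p = \<zeta> - of_real (c - r)" and "q = \<zeta> - of_real (c + r)"
  have nz: "p \<noteq> 0" "q \<noteq> 0" using im by (auto simp: p_def q_def complex_eq_iff)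
  have "1 / p - 1 / q = of_real (- 2 * r) / (p * q)"
    using nz by (simp add: p_def q_def field_simps)
  then have "cmod (1 / p - 1 / q) = 2 * r / (cmod p * cmod q)" using r by (simp add: norm_divide norm_mult)
  \<comment> \<open>\<open>2 * r * Im \<zeta>\<close> is twice the area of the triangle with
    vertices \<open>\<zeta>\<close>, \<open>c - r\<close>, \<open>c + r\<close>, hence at most the
    product of two of its sides.\<close>
  moreover have "Im (p * cnj q) = - (2 * r * Im \<zeta>)" by (simp add: p_def q_def algebra_simps)
  then have "2 * r * Im \<zeta> \<le> cmod p * cmod q"
    using abs_Im_le_cmod[of "p * cnj q"] by (simp add: norm_mult)
  ultimately have "cmod (1 / p - 1 / q) \<le> 1 / Im \<zeta>"
    using nz im by (simp add: divide_le_eq le_divide_eq mult.commute)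
  then show "cmod (1 / (\<zeta> - of_real (c - r)) - 1 / (\<zeta> - of_real (c + r))) \<le> 1 / Im \<zeta>"
    by (simp only: p_def q_def)
next
  fix s
  define p q where "p = \<gamma> s - of_real (c - r)" and "q = \<gamma> s - of_real (c + r)"
  have pos: "cosh s > 0" by (rule cosh_real_pos)
  have p: "p = Complex (r * (1 + tanh s)) (r * (1 / cosh s))" and q: "q = Complex (- r * (1 - tanh s)) (r * (1 / cosh s))"
    by (simp_all add: p_def q_def \<gamma>_def complex_eq_iff algebra_simps)
  have nz: "p \<noteq> 0" "q \<noteq> 0" using r pos by (auto simp: p q complex_eq_iff)
  have "(cmod p)\<^sup>2 = r\<^sup>2 * ((1 / cosh s)\<^sup>2 + (tanh s)\<^sup>2 + 1 + 2 * tanh s)" unfolding p cmod_power2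
    by (simp add: power2_eq_square algebra_simps)
  then have p2: "(cmod p)\<^sup>2 = 2 * r\<^sup>2 * (1 + tanh s)" unfolding sech_tanh_sq by simp
  have "(cmod q)\<^sup>2 = r\<^sup>2 * ((1 / cosh s)\<^sup>2 + (tanh s)\<^sup>2 + 1 - 2 * tanh s)" unfolding q cmod_power2
    by (simp add: power2_eq_square algebra_simps)
  then have q2: "(cmod q)\<^sup>2 = 2 * r\<^sup>2 * (1 - tanh s)" unfolding sech_tanh_sq by simp
  \<comment> \<open>The ratio of \<open>1 + tanh s\<close> to \<open>1 - tanh s\<close> is
    \<open>exp (2 * s)\<close>, so the moduli of \<open>p\<close> and \<open>q\<close> differ by the
    factor \<open>exp s\<close>.\<close>
  have "cosh s * (1 + tanh s) = exp (2 * s) * (cosh s * (1 - tanh s))"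
  proof -
    have "cosh s * (1 + tanh s) = cosh s + sinh s" "cosh s * (1 - tanh s) = cosh s - sinh s"
      using pos by (simp_all add: tanh_def field_simps)
    then show ?thesis by (simp add: cosh_plus_sinh cosh_minus_sinh flip: exp_add)
  qed
  then have "cosh s * (1 + tanh s) = cosh s * ((exp s)\<^sup>2 * (1 - tanh s))"
    by (simp only: exp_double mult.left_commute)
  then have e: "1 + tanh s = (exp s)\<^sup>2 * (1 - tanh s)" using pos by (metis mult_cancel_left less_irrefl)
  have "(cmod p)\<^sup>2 = (exp s * cmod q)\<^sup>2"
    unfolding power_mult_distrib p2 q2 e by (simp only: mult_ac)
  then have "cmod p = exp s * cmod q" by (simp add: power2_eq_iff_nonneg)
  then have "ln (cmod p) = s + ln (cmod q)" using nz by (simp add: ln_mult)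
  then have "Re (Ln p - Ln q) = s"
    using nz by (simp add: Re_Ln)
  then show "Re (Ln (\<gamma> s - of_real (c - r)) - Ln (\<gamma> s - of_real (c + r))) = s"
    by (simp only: p_def q_def)
qed

lemma semicircle_param:
  assumes "Im z > 0" "r > 0" "cmod (z - of_real c) = r"
  shows "\<exists>s. z = Complex (c + r * tanh s) (r / cosh s)"
proof -
  \<comment> \<open>On the semicircle the ratio of \<open>r * tanh s\<close> to
    \<open>r / cosh s\<close> is \<open>sinh s\<close>.\<close>
  define s where "s = arsinh ((Re z - c) / Im z)"
  have r2: "r\<^sup>2 = (Re z - c)\<^sup>2 + (Im z)\<^sup>2" unfolding assms(3)[symmetric] by (simp add: cmod_power2)
  have "cosh s = sqrt (((Re z - c) / Im z)\<^sup>2 + 1)" by (simp add: s_def cosh_arsinh_real)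
  also have "((Re z - c) / Im z)\<^sup>2 + 1 = (r / Im z)\<^sup>2" unfolding power_divide r2 using assms by (simp add: field_simps)
  also have "sqrt \<dots> = r / Im z" using assms by simp
  finally have "cosh s = r / Im z" .
  then have "z = Complex (c + r * tanh s) (r / cosh s)"
    using assms(1,2) by (simp add: tanh_def s_def complex_eq_iff)
  then show ?thesis by blast
qed

text \<open>Two points lie on a common vertical line or on a common semicircle centred on the real
  axis, where the distance is a difference of parameters.\<close>

theorem cosh_hyp_dist:
  assumes "Im z > 0" "Im w > 0"
  shows "cosh (hyp_dist z w) = 1 + (cmod (z - w))\<^sup>2 / (2 * Im z * Im w)" and "hyp_dist z w \<ge> 0"
proof -
  have "cosh (hyp_dist z w) = 1 + (cmod (z - w))\<^sup>2 / (2 * Im z * Im w) \<and> hyp_dist z w \<ge> 0"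
  proof (cases "Re z = Re w")
    case True
    have z: "z = Complex (Re z) (exp (ln (Im z)))" and w: "w = Complex (Re z) (exp (ln (Im w)))"
      using assms True by (simp_all add: complex_eq_iff)
    have d: "hyp_dist z w = \<bar>ln (Im w) - ln (Im z)\<bar>" by (subst z, subst w) (rule hyp_dist_vertical)
    have "cosh (hyp_dist z w) = cosh (ln (Im w / Im z))" using assms by (simp add: d ln_div cosh_real_abs)
    also have "\<dots> = (Im w / Im z + Im z / Im w) / 2" using assms by (simp add: cosh_ln_real)
    also have "\<dots> = 1 + (cmod (z - w))\<^sup>2 / (2 * Im z * Im w)"
      using assms unfolding cmod_power2 by (simp add: True field_simps power2_eq_square)
    finally show ?thesis by (simp add: d)
  next
    case False
    \<comment> \<open>The point of the real axis at equal Euclidean distance from \<open>z\<close>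
      and \<open>w\<close>.\<close>
    define c where "c = ((cmod z)\<^sup>2 - (cmod w)\<^sup>2) / (2 * (Re z - Re w))"
    define r where "r = cmod (z - of_real c)"
    have "2 * c * (Re z - Re w) = (cmod z)\<^sup>2 - (cmod w)\<^sup>2" using False by (simp add: c_def del: right_diff_distrib_numeral)
    then have "(cmod (w - of_real c))\<^sup>2 = r\<^sup>2"
      unfolding r_def cmod_power2 by (simp add: power2_eq_square algebra_simps)
    then have rw: "cmod (w - of_real c) = r" by (simp add: r_def)
    have r: "r > 0" using assms by (auto simp: r_def complex_eq_iff)
    obtain s where s: "z = Complex (c + r * tanh s) (r / cosh s)"
      using semicircle_param[OF assms(1) r] r_def by blast
    obtain t where t: "w = Complex (c + r * tanh t) (r / cosh t)"
      using semicircle_param[OF assms(2) r rw] by blast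
    have d: "hyp_dist z w = \<bar>t - s\<bar>" unfolding s t by (rule hyp_dist_semicircle[OF r])
    have pos: "cosh s > 0" "cosh t > 0" by (rule cosh_real_pos)+
    have "(cmod (z - w))\<^sup>2 = r\<^sup>2 * (((1 / cosh s)\<^sup>2 + (tanh s)\<^sup>2) + ((1 / cosh t)\<^sup>2 + (tanh t)\<^sup>2)
        - 2 * tanh s * tanh t - 2 / (cosh s * cosh t))"
      unfolding cmod_power2 by (simp add: s t power2_eq_square algebra_simps)
    also have "\<dots> = 2 * Im z * Im w * (cosh (t - s) - 1)"
      unfolding sech_tanh_sq using pos r by (simp add: s t cosh_diff tanh_def field_simps power2_eq_square)
    finally have "(cmod (z - w))\<^sup>2 / (2 * Im z * Im w) = cosh (t - s) - 1"
      using assms by simp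
    then show ?thesis by (simp add: d cosh_real_abs)
  qed
  then show "cosh (hyp_dist z w) = 1 + (cmod (z - w))\<^sup>2 / (2 * Im z * Im w)" "hyp_dist z w \<ge> 0" by auto
qed

section \<open>The action of the modular group\<close>

definition mat2 :: "int \<Rightarrow> int \<Rightarrow> int \<Rightarrow> int \<Rightarrow> int ^ 2 ^ 2" where
  "mat2 a b c d = vector [vector [a, b], vector [c, d]]"

lemma mat2_nth [simp]:
  "mat2 a b c d $ 1 $ 1 = a" "mat2 a b c d $ 1 $ 2 = b"
  "mat2 a b c d $ 2 $ 1 = c" "mat2 a b c d $ 2 $ 2 = d"
  by (simp_all add: mat2_def vector_2)

lemma det_mat2: "det (mat2 a b c d) = a * d - b * c"
  by (simp add: det_2)

lemma mat2_cases: obtains a b c d where "M = mat2 a b c d"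
proof
  show "M = mat2 (M $ 1 $ 1) (M $ 1 $ 2) (M $ 2 $ 1) (M $ 2 $ 2)"
    by (simp add: vec_eq_iff forall_2)
qed

lemma mat2_mult:
  "mat2 a b c d ** mat2 a' b' c' d' =
    mat2 (a * a' + b * c') (a * b' + b * d') (c * a' + d * c') (c * b' + d * d')"
  by (simp add: vec_eq_iff forall_2 matrix_matrix_mult_def sum_2)

lemma GL2Z_mult: "M \<in> GL2Z \<Longrightarrow> N \<in> GL2Z \<Longrightarrow> M ** N \<in> GL2Z"
  by (auto simp: GL2Z_def det_mul)

lemma mob_denom_nonzero:
  assumes "Im z \<noteq> 0" "a * d - b * c \<noteq> (0::int)"
  shows "of_int c * z + of_int d \<noteq> (0::complex)"
proof
  assume 0: "of_int c * z + of_int d = (0::complex)"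
  then have "Im (of_int c * z + of_int d) = 0" by simp
  then have "c = 0" using assms by simp
  with 0 assms show False by simp
qed

lemma mob_compose:
  fixes X Y :: complex
  assumes "Y \<noteq> 0"
  shows "(a * (X / Y) + b) / (c * (X / Y) + d) = (a * X + b * Y) / (c * X + d * Y)"
proof -
  have "a * (X / Y) + b = (a * X + b * Y) / Y" "c * (X / Y) + d = (c * X + d * Y) / Y"
    using assms by (simp_all add: field_simps)
  then show ?thesis using assms by simp
qed

text \<open>Moebius maps with integer coefficients commute with conjugation and determinants
  multiply, so only the parity of the number of conjugations matters; \<open>w\<close> records
  it.\<close>

lemma act_mult:
  assumes "M \<in> GL2Z" "N \<in> GL2Z" "Im z > 0"
  shows "act (M ** N) z = act M (act N z)"
proof -
  obtain a b c d where M: "M = mat2 a b c d" by (rule mat2_cases)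
  obtain a' b' c' d' where N: "N = mat2 a' b' c' d'" by (rule mat2_cases)
  define w where "w = (if det M = 1 then if det N = 1 then z else cnj z else if det N = 1 then cnj z else z)"
  have dt: "a' * d' - b' * c' \<noteq> 0" using assms(2) by (auto simp: GL2Z_def N det_mat2)
  have w: "w = (if det (M ** N) = 1 then z else cnj z)"
    using assms by (auto simp: w_def det_mul GL2Z_def)
  have nz: "of_int c' * w + of_int d' \<noteq> 0"
    using mob_denom_nonzero[OF _ dt, of w] assms(3) by (auto simp: w_def)
  have "act M (act N z) = (of_int a * ((of_int a' * w + of_int b') / (of_int c' * w + of_int d')) + of_int b) /
      (of_int c * ((of_int a' * w + of_int b') / (of_int c' * w + of_int d')) + of_int d)"
    using assms by (auto simp: act_def Let_def w_def M N GL2Z_def)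
  also have "\<dots> = act (M ** N) z"
    unfolding mob_compose[OF nz] unfolding act_def Let_def w[symmetric] unfolding M N mat2_mult
    by (simp add: algebra_simps)
  finally show ?thesis by simp
qed

lemma Im_act_pos:
  assumes "M \<in> GL2Z" "Im z > 0"
  shows "Im (act M z) = Im z / (cmod (of_int (M $ 2 $ 1) * z + of_int (M $ 2 $ 2)))\<^sup>2" and "Im (act M z) > 0"
proof -
  obtain a b c d where M: "M = mat2 a b c d" by (rule mat2_cases)
  define w where "w = (if det M = 1 then z else cnj z)"
  have dt: "a * d - b * c = 1 \<or> a * d - b * c = -1" using assms by (simp add: M GL2Z_def det_mat2)
  have nz: "of_int c * z + of_int d \<noteq> 0"
    using mob_denom_nonzero[of z a d b c] dt assms(2) by auto
  have n: "(cmod (of_int c * w + of_int d))\<^sup>2 = (cmod (of_int c * z + of_int d))\<^sup>2"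
    by (simp add: w_def cmod_power2)
  have e: "act M z = (of_int a * w + of_int b) / (of_int c * w + of_int d)"
    by (simp add: act_def Let_def w_def M)
  have "Im (act M z) = Im ((of_int a * w + of_int b) * cnj (of_int c * w + of_int d)) / (cmod (of_int c * w + of_int d))\<^sup>2"
    unfolding e complex_div_cnj[of "of_int a * w + of_int b"] by (simp flip: of_real_power)
  also have "Im ((of_int a * w + of_int b) * cnj (of_int c * w + of_int d)) = of_int (a * d - b * c) * Im w"
    by (simp add: algebra_simps)
  \<comment> \<open>Determinant -1 comes with a conjugated argument, so the two signs
    cancel.\<close>
  also have "\<dots> = Im z" using dt by (auto simp: w_def M det_mat2 simp del: of_int_diff of_int_mult)
  finally show "Im (act M z) = Im z / (cmod (of_int (M $ 2 $ 1) * z + of_int (M $ 2 $ 2)))\<^sup>2"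
    by (simp add: n M)
  then show "Im (act M z) > 0" using nz assms(2) by (simp add: M)
qed

lemma Re_act:
  assumes "M \<in> GL2Z" "Im z > 0" "M = mat2 a b c d"
  shows "Re (act M z) = (of_int (a * c) * (cmod z)\<^sup>2 + of_int (a * d + b * c) * Re z + of_int (b * d)) /
      (cmod (of_int c * z + of_int d))\<^sup>2"
    and "(cmod (act M z))\<^sup>2 = (cmod (of_int a * z + of_int b))\<^sup>2 / (cmod (of_int c * z + of_int d))\<^sup>2"
proof -
  define w where "w = (if det M = 1 then z else cnj z)"
  have n: "(cmod (of_int e * w + of_int f))\<^sup>2 = (cmod (of_int e * z + of_int f))\<^sup>2" for e f
    by (simp add: w_def cmod_power2)
  have e: "act M z = (of_int a * w + of_int b) / (of_int c * w + of_int d)"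
    by (simp add: act_def Let_def w_def assms(3))
  have "Re (act M z) = Re ((of_int a * w + of_int b) * cnj (of_int c * w + of_int d)) / (cmod (of_int c * w + of_int d))\<^sup>2"
    unfolding e complex_div_cnj[of "of_int a * w + of_int b"] by (simp flip: of_real_power)
  also have "Re ((of_int a * w + of_int b) * cnj (of_int c * w + of_int d)) =
      of_int (a * c) * (cmod z)\<^sup>2 + of_int (a * d + b * c) * Re z + of_int (b * d)"
    unfolding cmod_power2 by (simp add: w_def power2_eq_square algebra_simps)
  finally show "Re (act M z) = (of_int (a * c) * (cmod z)\<^sup>2 + of_int (a * d + b * c) * Re z + of_int (b * d)) /
      (cmod (of_int c * z + of_int d))\<^sup>2"
    unfolding n .
  show "(cmod (act M z))\<^sup>2 = (cmod (of_int a * z + of_int b))\<^sup>2 / (cmod (of_int c * z + of_int d))\<^sup>2"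
    unfolding e by (simp add: norm_divide power_divide n)
qed

section \<open>Quadratic forms under the action\<close>

text \<open>Up to a factor, a positive definite form yields cosh of the distance to its root in the
  half-plane, while an indefinite one vanishes exactly on a geodesic.\<close>

definition qform :: "real \<Rightarrow> real \<Rightarrow> real \<Rightarrow> complex \<Rightarrow> real" where
  "qform A B C z = (A * (cmod z)\<^sup>2 + B * Re z + C) / Im z"

text \<open>The new coefficients arise by substituting \<open>a X + b Y\<close> and
  \<open>c X + d Y\<close> into the binary form \<open>A X^2 + B X Y + C Y^2\<close>. The factor |c
  z + d|^2 cancels, and conjugating \<open>z\<close> changes neither its real part nor its
  modulus.\<close>

lemma qform_act:
  assumes "mat2 a b c d \<in> GL2Z" "Im z > 0"
  shows "qform A B C (act (mat2 a b c d) z) =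
    qform (A * (of_int a)\<^sup>2 + B * of_int (a * c) + C * (of_int c)\<^sup>2)
      (2 * A * of_int (a * b) + B * of_int (a * d + b * c) + 2 * C * of_int (c * d))
      (A * (of_int b)\<^sup>2 + B * of_int (b * d) + C * (of_int d)\<^sup>2) z"
proof -
  define k where "k = (cmod (of_int c * z + of_int d))\<^sup>2"
  have "a * d - b * c \<noteq> 0" using assms(1) by (auto simp: GL2Z_def det_mat2)
  then have k: "k > 0" using mob_denom_nonzero[of z a d b c] assms(2) by (simp add: k_def)
  have 1: "Im (act (mat2 a b c d) z) = Im z / k" using Im_act_pos(1)[OF assms] by (simp add: k_def)
  note 2 = Re_act[OF assms refl, folded k_def]
  have "qform A B C (act (mat2 a b c d) z) = (A * (cmod (of_int a * z + of_int b))\<^sup>2 +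
      B * (of_int (a * c) * (cmod z)\<^sup>2 + of_int (a * d + b * c) * Re z + of_int (b * d)) + C * k) / Im z"
    unfolding qform_def 1 2 using k assms(2) by (simp add: field_simps)
  also have "\<dots> = qform (A * (of_int a)\<^sup>2 + B * of_int (a * c) + C * (of_int c)\<^sup>2)
      (2 * A * of_int (a * b) + B * of_int (a * d + b * c) + 2 * C * of_int (c * d))
      (A * (of_int b)\<^sup>2 + B * of_int (b * d) + C * (of_int d)\<^sup>2) z"
    unfolding qform_def k_def cmod_power2 by (simp add: power2_eq_square algebra_simps)
  finally show ?thesis .
qed

section \<open>Orbits and reduction to the fundamental triangle\<close>

definition orbit_rel :: "complex \<Rightarrow> complex \<Rightarrow> bool" where
  "orbit_rel z w \<longleftrightarrow> (\<exists>M\<in>GL2Z. w = act M z)"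

lemma orbit_rel_mat2:
  assumes "a * d - b * c = 1 \<or> a * d - b * c = -1" "w = act (mat2 a b c d) z"
  shows "orbit_rel z w"
  using assms unfolding orbit_rel_def GL2Z_def by (intro bexI[of _ "mat2 a b c d"]) (auto simp: det_mat2)

lemma orbit_rel_refl: "orbit_rel z z"
  by (rule orbit_rel_mat2[of 1 1 0 0]) (auto simp: act_def det_mat2)

lemma orbit_rel_trans:
  assumes "orbit_rel z w" "orbit_rel w u" "Im z > 0"
  shows "orbit_rel z u"
  using assms act_mult GL2Z_mult unfolding orbit_rel_def by metis

text \<open>Needed for inverses: the adjugate inverts a matrix up to the scalar
  \<open>a * d - b * c\<close>, which is 1 or -1.\<close>

lemma act_scalar: "k = 1 \<or> k = -1 \<Longrightarrow> act (mat2 k 0 0 k) z = z"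
  by (auto simp: act_def det_mat2)

lemma act_inverse:
  assumes M: "mat2 a b c d \<in> GL2Z" and z: "Im z > 0"
  shows "mat2 d (- b) (- c) a \<in> GL2Z" "act (mat2 d (- b) (- c) a) (act (mat2 a b c d) z) = z"
proof -
  show I: "mat2 d (- b) (- c) a \<in> GL2Z" using M by (simp add: GL2Z_def det_mat2 algebra_simps)
  have dt: "a * d - b * c = 1 \<or> a * d - b * c = -1" using M by (simp add: GL2Z_def det_mat2)
  have "act (mat2 d (- b) (- c) a) (act (mat2 a b c d) z) = act (mat2 (a * d - b * c) 0 0 (a * d - b * c)) z"
    using act_mult[OF I M z] by (simp add: mat2_mult algebra_simps)
  also have "\<dots> = z" using dt by (rule act_scalar)
  finally show "act (mat2 d (- b) (- c) a) (act (mat2 a b c d) z) = z" .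
qed

lemma orbit_rel_sym:
  assumes "orbit_rel z w" "Im z > 0"
  shows "orbit_rel w z"
proof -
  obtain M where M: "M \<in> GL2Z" "w = act M z" using assms(1) by (auto simp: orbit_rel_def)
  obtain a b c d where "M = mat2 a b c d" by (rule mat2_cases)
  then show ?thesis using act_inverse[of a b c d z] M assms(2) unfolding orbit_rel_def by metis
qed

lemma orbit_rel_Im_pos: "orbit_rel z w \<Longrightarrow> Im z > 0 \<Longrightarrow> Im w > 0"
  by (auto simp: orbit_rel_def intro: Im_act_pos(2))

lemma orbit_rel_translate: "orbit_rel z (z + of_int n)"
  by (rule orbit_rel_mat2[of 1 1 n 0]) (auto simp: act_def det_mat2)

lemma orbit_rel_reflect: "orbit_rel z (- cnj z)"
  by (rule orbit_rel_mat2[of "-1" 1 0 0]) (auto simp: act_def det_mat2)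

lemma orbit_rel_invert: "orbit_rel z (1 / cnj z)"
  by (rule orbit_rel_mat2[of 0 0 1 1]) (auto simp: act_def det_mat2)

text \<open>The height of \<open>act M z\<close> is Im z / |c z + d|^2, so not dropping below
  \<open>Im z\<close> forces |c z + d| \<le> 1, which leaves finitely many integer pairs (c,
  d).\<close>

lemma finite_orbit_Im_ge:
  assumes z: "Im z > 0"
  shows "finite {h. Im z \<le> h \<and> (\<exists>w. orbit_rel z w \<and> h = Im w)}" (is "finite ?V")
proof -
  define m where "m = \<lceil>1 / Im z\<rceil>"
  define l where "l = \<lceil>1 + of_int m * \<bar>Re z\<bar>\<rceil>"
  have "?V \<subseteq> (\<lambda>(c, d). Im z / (cmod (of_int c * z + of_int d))\<^sup>2) ` ({-m..m} \<times> {-l..l})"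
  proof
    fix h assume "h \<in> ?V"
    then obtain M where M: "M \<in> GL2Z" and h: "h = Im (act M z)" "Im z \<le> h" by (auto simp: orbit_rel_def)
    define c d where "c = M $ 2 $ 1" and "d = M $ 2 $ 2"
    define k where "k = of_int c * z + of_int d"
    have h': "h = Im z / (cmod k)\<^sup>2" unfolding h k_def c_def d_def by (rule Im_act_pos[OF M z])
    \<comment> \<open>For \<open>k = 0\<close> the quotient would be 0 by convention, hence below
      \<open>Im z\<close>.\<close>
    have "k \<noteq> 0" using h' h(2) z by auto
    then have "Im z * (cmod k)\<^sup>2 \<le> Im z * 1" using h(2) z unfolding h' by (simp add: field_simps)
    then have "(cmod k)\<^sup>2 \<le> 1\<^sup>2" using z by simp
    then have k1: "cmod k \<le> 1" by (rule power2_le_imp_le) simp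
    have "\<bar>of_int c * Im z\<bar> \<le> 1" using abs_Im_le_cmod[of k] k1 by (simp add: k_def)
    then have "\<bar>real_of_int c\<bar> \<le> 1 / Im z" using z by (simp add: abs_mult field_simps)
    also have "\<dots> \<le> of_int m" by (simp add: m_def)
    finally have cm: "\<bar>real_of_int c\<bar> \<le> of_int m" .
    have "\<bar>real_of_int c * Re z + of_int d\<bar> \<le> 1" using abs_Re_le_cmod[of k] k1 by (simp add: k_def)
    moreover have "\<bar>real_of_int c * Re z\<bar> \<le> of_int m * \<bar>Re z\<bar>" unfolding abs_mult using cm by (intro mult_right_mono) auto
    ultimately have "\<bar>real_of_int d\<bar> \<le> 1 + of_int m * \<bar>Re z\<bar>" by linarith
    also have "\<dots> \<le> of_int l" by (simp add: l_def)
    finally have "\<bar>real_of_int d\<bar> \<le> of_int l" .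
    with cm have "(c, d) \<in> {-m..m} \<times> {-l..l}" by auto
    then show "h \<in> (\<lambda>(c, d). Im z / (cmod (of_int c * z + of_int d))\<^sup>2) ` ({-m..m} \<times> {-l..l})"
      unfolding h' k_def by force
  qed
  then show ?thesis by (rule finite_subset) auto
qed

text \<open>A point of maximal height in the orbit is moved into the strip by a translation and a
  reflection, which keep the height. Inversion in the unit circle divides the height by |u|^2, so
  maximality gives |u| \<ge> 1.\<close>

lemma fund_triangle_reduction:
  assumes z: "Im z > 0"
  shows "\<exists>w\<in>fund_triangle. orbit_rel z w"
proof -
  define V where "V = {h. Im z \<le> h \<and> (\<exists>w. orbit_rel z w \<and> h = Im w)}"
  have fin: "finite V" unfolding V_def by (rule finite_orbit_Im_ge[OF z])
  have "Im z \<in> V" using orbit_rel_refl by (auto simp: V_def)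
  then have "Max V \<in> V" using fin by (intro Max_in) auto
  then obtain w where w: "orbit_rel z w" "Im w = Max V" "Im z \<le> Im w" by (auto simp: V_def)
  have max: "Im u \<le> Im w" if "orbit_rel z u" for u
  proof (cases "Im z \<le> Im u")
    case True
    then have "Im u \<in> V" using that by (auto simp: V_def)
    then show ?thesis using fin by (simp add: w)
  qed (use w in linarith)
  define n where "n = round (Re w)"
  define v where "v = w + of_int (- n)"
  define u where "u = (if Re v \<ge> 0 then v else - cnj v)"
  have "orbit_rel z v" unfolding v_def by (rule orbit_rel_trans[OF w(1) orbit_rel_translate z])
  then have zu: "orbit_rel z u" using orbit_rel_trans[OF _ orbit_rel_reflect z] by (simp add: u_def)
  have Imu: "Im u = Im w" by (simp add: u_def v_def)
  have pos: "Im u > 0" using orbit_rel_Im_pos[OF zu z] .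
  have "\<bar>Re v\<bar> \<le> 1/2" using of_int_round_abs_le[of "Re w"] by (simp add: v_def n_def abs_minus_commute)
  then have Re: "0 \<le> Re u" "Re u \<le> 1/2" by (auto simp: u_def)
  have u0: "u \<noteq> 0" using pos by auto
  have "Im (1 / cnj u) \<le> Im u" unfolding Imu by (rule max) (rule orbit_rel_trans[OF zu orbit_rel_invert z])
  moreover have "Im (1 / cnj u) = Im u / (cmod u)\<^sup>2" by (simp add: Im_divide cmod_power2)
  ultimately have "Im u * 1 \<le> Im u * (cmod u)\<^sup>2" using pos u0 by (simp add: field_simps)
  then have "1\<^sup>2 \<le> (cmod u)\<^sup>2" using pos by simp
  then have "1 \<le> cmod u" by (rule power2_le_imp_le) simp
  then have "u \<in> fund_triangle" using pos Re by (simp add: fund_triangle_def upper_half_plane_def)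
  then show ?thesis using zu by blast
qed

section \<open>Distances from orbits to \<open>\<rho>\<close>\<close>

definition rho_form :: "complex \<Rightarrow> real" where
  "rho_form = qform 1 (- 1) 1"

lemma cosh_hyp_dist_rho:
  assumes "Im z > 0"
  shows "cosh (hyp_dist z rho) = rho_form z / sqrt 3"
proof -
  have "(cmod (z - rho))\<^sup>2 = (cmod z)\<^sup>2 - Re z + 1 - sqrt 3 * Im z"
    unfolding cmod_power2 by (simp add: rho_def power2_eq_square algebra_simps)
  then show ?thesis
    using assms cosh_hyp_dist(1)[OF assms, of rho]
    by (simp add: rho_form_def qform_def rho_def field_simps)
qed

lemma sinh_hyp_dist_rho:
  assumes "Im z > 0"
  shows "(sinh (hyp_dist z rho))\<^sup>2 = (rho_form z)\<^sup>2 / 3 - 1" "sinh (hyp_dist z rho) \<ge> 0" "hyp_dist z rho \<ge> 0"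
proof -
  show d: "hyp_dist z rho \<ge> 0" using cosh_hyp_dist(2)[OF assms, of rho] by (simp add: rho_def)
  then show "sinh (hyp_dist z rho) \<ge> 0" by simp
  show "(sinh (hyp_dist z rho))\<^sup>2 = (rho_form z)\<^sup>2 / 3 - 1"
    unfolding sinh_square_eq cosh_hyp_dist_rho[OF assms] by (simp add: power_divide)
qed

text \<open>Completing the square turns the hyperbolic disc around \<open>rho\<close> into a
  Euclidean one; \<open>k = 2\<close> gives radius 1/2.\<close>

lemma rho_form_le_iff:
  assumes "Im z > 0"
  shows "rho_form z \<le> k \<longleftrightarrow> (Re z - 1/2)\<^sup>2 + (Im z - k/2)\<^sup>2 \<le> (k\<^sup>2 - 3) / 4"
proof -
  have "rho_form z \<le> k \<longleftrightarrow> (cmod z)\<^sup>2 - Re z + 1 \<le> k * Im z"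
    using assms by (simp add: rho_form_def qform_def field_simps)
  moreover have "(Re z - 1/2)\<^sup>2 + (Im z - k/2)\<^sup>2 - (k\<^sup>2 - 3) / 4 = (cmod z)\<^sup>2 - Re z + 1 - k * Im z"
    unfolding cmod_power2 by (simp add: power2_eq_square field_simps)
  ultimately show ?thesis by linarith
qed

text \<open>The discriminant -3 of the form of \<open>rho\<close> is multiplied by the square of the
  determinant, which is 1. Completed squares show that \<open>A\<close> and \<open>C\<close> are
  nonnegative, and \<open>4 * A * C = B\<^sup>2 + 3\<close> rules out 0.\<close>

lemma rho_form_act:
  assumes "M \<in> GL2Z"
  obtains A B C :: int where "4 * A * C = B\<^sup>2 + 3" "A \<ge> 1" "C \<ge> 1"
    "\<And>z. Im z > 0 \<Longrightarrow> rho_form (act M z) = qform (of_int A) (of_int B) (of_int C) z"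
proof -
  obtain a b c d where M: "M = mat2 a b c d" by (rule mat2_cases)
  have dt: "a * d - b * c = 1 \<or> a * d - b * c = -1" using assms by (simp add: M GL2Z_def det_mat2)
  define A B C where "A = a\<^sup>2 - a * c + c\<^sup>2" and "B = 2 * a * b - (a * d + b * c) + 2 * c * d"
    and "C = b\<^sup>2 - b * d + d\<^sup>2"
  have "4 * A * C = B\<^sup>2 + 3 * (a * d - b * c)\<^sup>2"
    by (simp add: A_def B_def C_def power2_eq_square algebra_simps)
  then have AC: "4 * A * C = B\<^sup>2 + 3" using dt by auto
  have "4 * A = (2 * a - c)\<^sup>2 + 3 * c\<^sup>2" "4 * C = (2 * b - d)\<^sup>2 + 3 * d\<^sup>2"
    by (simp_all add: A_def C_def power2_eq_square algebra_simps)
  then have "4 * A \<ge> 0" "4 * C \<ge> 0" by (metis add_nonneg_nonneg zero_le_power2 mult_nonneg_nonneg zero_le_numeral)+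
  moreover have "B\<^sup>2 + 3 \<noteq> 0" using zero_le_power2[of B] by linarith
  then have "A \<noteq> 0" "C \<noteq> 0" using AC by auto
  ultimately have "A \<ge> 1" "C \<ge> 1" by auto
  moreover have "rho_form (act M z) = qform (of_int A) (of_int B) (of_int C) z" if "Im z > 0" for z
    using qform_act[of a b c d z 1 "-1" 1] assms that
    by (simp add: rho_form_def M A_def B_def C_def algebra_simps)
  ultimately show thesis using AC that by blast
qed

text \<open>For fixed real part the form is A y + K / y, so this is the inequality of arithmetic and
  geometric means; in squared form it holds for either sign of K.\<close>

lemma qform_vertical_ge:
  assumes "A \<ge> 0" "Im z > 0"
  shows "(qform A B C z)\<^sup>2 \<ge> 4 * A * (A * (Re z)\<^sup>2 + B * Re z + C)"
proof -
  define y where "y = Im z"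
  define K where "K = A * (Re z)\<^sup>2 + B * Re z + C"
  have "qform A B C z = (A * y\<^sup>2 + K) / y"
    unfolding qform_def cmod_power2 by (simp add: y_def K_def algebra_simps)
  then have "(qform A B C z)\<^sup>2 * y\<^sup>2 = (A * y\<^sup>2 + K)\<^sup>2" using assms by (simp add: y_def power_divide)
  also have "\<dots> = (A * y\<^sup>2 - K)\<^sup>2 + 4 * A * K * y\<^sup>2" by (simp add: power2_eq_square algebra_simps)
  finally have "4 * A * K * y\<^sup>2 \<le> (qform A B C z)\<^sup>2 * y\<^sup>2" by simp
  moreover have "y\<^sup>2 > 0" using assms by (simp add: y_def)
  ultimately show ?thesis unfolding K_def by (rule mult_right_le_imp_le)
qed

text \<open>The difference of the numerators is (A - 1)(|z|^2 - 1) plus a term affine in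
  \<open>Re z\<close>. The latter needs checking only at one end of [0, 1/2]: at 0 for
  \<open>B \<ge> -1\<close>, at 1/2 otherwise.\<close>

lemma rho_form_le_act:
  assumes z: "z \<in> fund_triangle" and M: "M \<in> GL2Z"
  shows "rho_form z \<le> rho_form (act M z)"
proof -
  have im: "Im z > 0" and Re: "0 \<le> Re z" "Re z \<le> 1/2" and n: "1 \<le> cmod z"
    using z by (auto simp: fund_triangle_def upper_half_plane_def)
  obtain A B C :: int where AC: "4 * A * C = B\<^sup>2 + 3" and pos: "A \<ge> 1" "C \<ge> 1"
    and f: "\<And>z. Im z > 0 \<Longrightarrow> rho_form (act M z) = qform (of_int A) (of_int B) (of_int C) z"
    by (rule rho_form_act[OF M]) (rule that)
  have n2: "(cmod z)\<^sup>2 \<ge> 1" using n by (simp add: one_le_power)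
  have "(real_of_int A - 1) * (cmod z)\<^sup>2 \<ge> (real_of_int A - 1) * 1"
    using pos n2 by (intro mult_left_mono) auto
  moreover have "of_int (A + C - 2) + of_int (B + 1) * Re z \<ge> (0::real)"
  proof (cases "B \<ge> -1")
    case True
    then have "of_int (B + 1) * Re z \<ge> 0" using Re by (intro mult_nonneg_nonneg) auto
    moreover have "real_of_int (A + C - 2) \<ge> 0" using pos by linarith
    ultimately show ?thesis by linarith
  next
    case False
    \<comment> \<open>At real part 1/2 the claim reads \<open>3 - B \<le> 2 * (A + C)\<close>; it is
      obtained by comparing squares.\<close>
    have "(2 * (A + C))\<^sup>2 = 4 * (A - C)\<^sup>2 + 4 * (4 * A * C)" by (simp add: power2_eq_square algebra_simps)
    also have "\<dots> = 4 * (A - C)\<^sup>2 + (3 - B)\<^sup>2 + 3 * (B + 1)\<^sup>2"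
      unfolding AC by (simp add: power2_eq_square algebra_simps)
    finally have "(3 - B)\<^sup>2 \<le> (2 * (A + C))\<^sup>2" by simp
    then have "3 - B \<le> 2 * (A + C)" by (rule power2_le_imp_le) (use pos in simp)
    then have "real_of_int (3 - B) \<le> real_of_int (2 * (A + C))" by (simp only: of_int_le_iff)
    moreover have "of_int (B + 1) * Re z \<ge> of_int (B + 1) * (1/2)"
      using False Re by (intro mult_left_mono_neg) auto
    ultimately show ?thesis unfolding of_int_add of_int_diff of_int_mult by simp
  qed
  moreover have "of_int A * (cmod z)\<^sup>2 + of_int B * Re z + of_int C - ((cmod z)\<^sup>2 - Re z + 1) =
      ((real_of_int A - 1) * (cmod z)\<^sup>2 - (real_of_int A - 1) * 1) + (of_int (A + C - 2) + of_int (B + 1) * Re z)"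
    by (simp add: algebra_simps)
  ultimately have le: "(cmod z)\<^sup>2 - Re z + 1 \<le> of_int A * (cmod z)\<^sup>2 + of_int B * Re z + of_int C"
    by linarith
  have "((cmod z)\<^sup>2 - Re z + 1) / Im z \<le> (of_int A * (cmod z)\<^sup>2 + of_int B * Re z + of_int C) / Im z"
    using le im by (intro divide_right_mono) auto
  then show ?thesis unfolding f[OF im] by (simp add: rho_form_def qform_def)
qed

section \<open>Billiards as point sets and geodesics as zero sets of forms\<close>

lemma geodesic_field:
  assumes "(p, q) \<in> geodesic \<alpha> \<beta>"
  shows "(p, p) \<in> geodesic \<alpha> \<beta>" "(q, q) \<in> geodesic \<alpha> \<beta>"
  using assms by (cases \<alpha>; cases \<beta>; auto)+

text \<open>The relations are reflexive on their points, so a point of an orbit geodesic in the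
  triangle already gives a nonempty segment, and discarding empty segments loses nothing.\<close>

lemma billiard_points_iff:
  "p \<in> billiard_points (billiard (geodesic \<alpha> \<beta>)) \<longleftrightarrow>
    p \<in> fund_triangle \<and> (\<exists>M\<in>GL2Z. \<exists>q. (q, q) \<in> geodesic \<alpha> \<beta> \<and> p = act M q)" (is "?L \<longleftrightarrow> ?R")
proof
  assume ?L
  then obtain M where M: "M \<in> GL2Z"
    and p: "p \<in> Field (Restr (map_prod (act M) (act M) ` geodesic \<alpha> \<beta>) fund_triangle)"
    by (auto simp: billiard_points_def billiard_def orbit_def)
  then obtain r where "(p, r) \<in> Restr (map_prod (act M) (act M) ` geodesic \<alpha> \<beta>) fund_triangle \<or>
      (r, p) \<in> Restr (map_prod (act M) (act M) ` geodesic \<alpha> \<beta>) fund_triangle"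
    by (auto simp: Field_def)
  then obtain u v where "p \<in> fund_triangle" "(u, v) \<in> geodesic \<alpha> \<beta>" "p = act M u \<or> p = act M v"
    by auto
  then show ?R using M geodesic_field[of u v \<alpha> \<beta>] by blast
next
  assume ?R
  then obtain M q where M: "M \<in> GL2Z" "(q, q) \<in> geodesic \<alpha> \<beta>" "p = act M q" "p \<in> fund_triangle" by blast
  define G where "G = map_prod (act M) (act M) ` geodesic \<alpha> \<beta>"
  have "map_prod (act M) (act M) (q, q) \<in> G" unfolding G_def using M(2) by (rule imageI)
  then have p: "(p, p) \<in> Restr G fund_triangle" using M(3,4) by simp
  have "G \<in> orbit (geodesic \<alpha> \<beta>)" using M(1) unfolding orbit_def G_def by blast
  then have "Restr G fund_triangle \<in> billiard (geodesic \<alpha> \<beta>)"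
    using p unfolding billiard_def by (intro DiffI CollectI exI[of _ G] conjI refl) auto
  moreover have "p \<in> Field (Restr G fund_triangle)" using p by (rule FieldI1)
  ultimately show ?L unfolding billiard_points_def by (rule UN_I)
qed

lemma geodesic_Im_pos: "(q, q) \<in> geodesic \<alpha> \<beta> \<Longrightarrow> Im q > 0"
  by (cases \<alpha>; cases \<beta>) (auto simp: upper_half_plane_def)

text \<open>Puts semicircles and vertical lines on the same footing: the binary form has the two
  endpoints as its roots, with \<open>A = 0\<close> when one of them is infinity.\<close>

lemma geodesic_equation:
  assumes "\<alpha> \<noteq> \<beta>"
  obtains A B C where "B\<^sup>2 - 4 * A * C > 0"
    "\<And>q. (q, q) \<in> geodesic \<alpha> \<beta> \<longleftrightarrow> Im q > 0 \<and> qform A B C q = 0"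
    "\<exists>q. (q, q) \<in> geodesic \<alpha> \<beta>"
proof (cases \<alpha>)
  case a: (Fin a)
  show thesis
  proof (cases \<beta>)
    case b: (Fin b)
    have ab: "a \<noteq> b" using assms a b by simp
    have sq: "cmod (q - of_real ((a + b) / 2)) = \<bar>b - a\<bar> / 2 \<longleftrightarrow>
        (cmod q)\<^sup>2 - (a + b) * Re q + a * b = 0" for q
    proof -
      have "cmod (q - of_real ((a + b) / 2)) = \<bar>b - a\<bar> / 2 \<longleftrightarrow>
          (cmod (q - of_real ((a + b) / 2)))\<^sup>2 = (\<bar>b - a\<bar> / 2)\<^sup>2"
        by (subst power2_eq_iff_nonneg) auto
      moreover have "(cmod (q - of_real ((a + b) / 2)))\<^sup>2 - (\<bar>b - a\<bar> / 2)\<^sup>2 =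
          (cmod q)\<^sup>2 - (a + b) * Re q + a * b"
        unfolding cmod_power2 power_divide power2_abs by (simp add: power2_eq_square field_simps)
      ultimately show ?thesis by linarith
    qed
    show thesis
    proof (rule that)
      have "(- (a + b))\<^sup>2 - 4 * 1 * (a * b) = (a - b)\<^sup>2" by (simp add: power2_eq_square algebra_simps)
      then show "(- (a + b))\<^sup>2 - 4 * 1 * (a * b) > 0" using ab by simp
      show "(q, q) \<in> geodesic \<alpha> \<beta> \<longleftrightarrow> Im q > 0 \<and> qform 1 (- (a + b)) (a * b) q = 0" for q
      proof -
        have g: "(q, q) \<in> geodesic \<alpha> \<beta> \<longleftrightarrow> Im q > 0 \<and> cmod (q - of_real ((a + b) / 2)) = \<bar>b - a\<bar> / 2"
          unfolding a b by (auto simp: upper_half_plane_def)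
        have f: "qform 1 (- (a + b)) (a * b) q = ((cmod q)\<^sup>2 - (a + b) * Re q + a * b) / Im q"
          by (simp add: qform_def algebra_simps)
        show ?thesis unfolding g f sq divide_eq_0_iff by auto
      qed
      have "cmod (Complex ((a + b) / 2) (\<bar>b - a\<bar> / 2) - of_real ((a + b) / 2)) = \<bar>b - a\<bar> / 2"
        by (simp add: cmod_def)
      then show "\<exists>q. (q, q) \<in> geodesic \<alpha> \<beta>"
        using ab by (intro exI[of _ "Complex ((a + b) / 2) (\<bar>b - a\<bar> / 2)"]) (simp add: a b upper_half_plane_def)
    qed
  next
    case b: Infty
    show thesis
    proof (rule that[of 1 0 "- a"])
      show "(q, q) \<in> geodesic \<alpha> \<beta> \<longleftrightarrow> Im q > 0 \<and> qform 0 1 (- a) q = 0" for q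
        by (auto simp: a b upper_half_plane_def qform_def)
      show "\<exists>q. (q, q) \<in> geodesic \<alpha> \<beta>"
        by (intro exI[of _ "Complex a 1"]) (simp add: a b upper_half_plane_def)
    qed simp
  qed
next
  case a: Infty
  then obtain b where b: "\<beta> = Fin b" using assms by (cases \<beta>) auto
  show thesis
  proof (rule that[of 1 0 "- b"])
    show "(q, q) \<in> geodesic \<alpha> \<beta> \<longleftrightarrow> Im q > 0 \<and> qform 0 1 (- b) q = 0" for q
      by (auto simp: a b upper_half_plane_def qform_def)
    show "\<exists>q. (q, q) \<in> geodesic \<alpha> \<beta>"
      by (intro exI[of _ "Complex b 1"]) (simp add: a b upper_half_plane_def)
  qed simp
qed

text \<open>Allows near points to be sought anywhere in the orbit, since folding back into the
  triangle never increases \<open>rho_form\<close>.\<close>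

lemma billiard_point_of_orbit:
  assumes "(q, q) \<in> geodesic \<alpha> \<beta>" "orbit_rel q z"
  shows "\<exists>p\<in>billiard_points (billiard (geodesic \<alpha> \<beta>)). rho_form p \<le> rho_form z"
proof -
  have q: "Im q > 0" using assms(1) by (rule geodesic_Im_pos)
  then have z: "Im z > 0" using assms(2) orbit_rel_Im_pos by blast
  obtain p where p: "p \<in> fund_triangle" "orbit_rel z p" using fund_triangle_reduction[OF z] by blast
  obtain M where "M \<in> GL2Z" "p = act M q" using orbit_rel_trans[OF assms(2) p(2) q] by (auto simp: orbit_rel_def)
  then have "p \<in> billiard_points (billiard (geodesic \<alpha> \<beta>))" using assms p(1) by (auto simp: billiard_points_iff)
  moreover obtain N where "N \<in> GL2Z" "z = act N p" using orbit_rel_sym[OF p(2) z] by (auto simp: orbit_rel_def)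
  then have "rho_form p \<le> rho_form z" using rho_form_le_act[OF p(1)] by simp
  ultimately show ?thesis by blast
qed

text \<open>This yields the lower bound for all values and also the nonemptiness of every
  billiard.\<close>

lemma billiard_meets_disc:
  assumes "\<alpha> \<noteq> \<beta>"
  shows "\<exists>p\<in>billiard_points (billiard (geodesic \<alpha> \<beta>)). rho_form p \<le> 2"
proof -
  obtain A B C where D: "B\<^sup>2 - 4 * A * C > 0"
    and eq: "\<And>q. (q, q) \<in> geodesic \<alpha> \<beta> \<longleftrightarrow> Im q > 0 \<and> qform A B C q = 0"
    and ex: "\<exists>q. (q, q) \<in> geodesic \<alpha> \<beta>"
    by (rule geodesic_equation[OF assms]) (rule that)
  obtain q where q: "(q, q) \<in> geodesic \<alpha> \<beta>" using ex by blast
  then have imq: "Im q > 0" using eq by blast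
  obtain z where z: "z \<in> fund_triangle" "orbit_rel q z" using fund_triangle_reduction[OF imq] by blast
  show ?thesis
  proof (cases "rho_form z \<le> 2")
    case True
    then show ?thesis using billiard_point_of_orbit[OF q z(2)] by (meson order_trans)
  next
    case False
    have imz: "Im z > 0" and Re: "0 \<le> Re z" "Re z \<le> 1/2" and n: "1 \<le> cmod z"
      using z by (auto simp: fund_triangle_def upper_half_plane_def)
    have y1: "Im z > 1"
    proof (rule ccontr)
      assume "\<not> Im z > 1"
      then have y: "Im z \<le> 1" by simp
      \<comment> \<open>With x = Re z and y = Im z, the inequalities chain to (1 - y)^2 \<le> 1 - y
        \<le> 1 - y^2 \<le> x^2 \<le> x/2, hence (1 - y)^2 + x^2 \<le> x, which places
        \<open>z\<close> in the disc.\<close>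
      have "(Re z)\<^sup>2 + (Im z)\<^sup>2 \<ge> 1" using one_le_power[OF n, of 2] by (simp add: cmod_power2)
      then have "(1 - Im z) * (1 + Im z) \<le> (Re z)\<^sup>2" by (simp add: power2_eq_square algebra_simps)
      moreover have "(1 - Im z) * 1 \<le> (1 - Im z) * (1 + Im z)" using y imz by (intro mult_left_mono) auto
      moreover have "(1 - Im z)\<^sup>2 \<le> (1 - Im z) * 1" unfolding power2_eq_square using y imz by (intro mult_left_mono) auto
      moreover have "(Re z)\<^sup>2 \<le> Re z * (1/2)" unfolding power2_eq_square using Re by (intro mult_left_mono) auto
      moreover have "(Im z - 1)\<^sup>2 + (Re z - 1/2)\<^sup>2 > 1/4" using False imz by (simp add: rho_form_le_iff)
      then have "(1 - Im z)\<^sup>2 + (Re z)\<^sup>2 > Re z" by (simp add: power2_eq_square algebra_simps)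
      ultimately show False by linarith
    qed
    obtain M where M: "M \<in> GL2Z" "q = act M z" using orbit_rel_sym[OF z(2) imq] by (auto simp: orbit_rel_def)
    obtain a b c d where M': "M = mat2 a b c d" by (rule mat2_cases)
    have dt: "a * d - b * c = 1 \<or> a * d - b * c = -1" using M(1) by (simp add: M' GL2Z_def det_mat2)
    \<comment> \<open>The equation of the geodesic moved so that it passes through \<open>z\<close>;
      its discriminant is unchanged.\<close>
    define A' B' C' where "A' = A * (of_int a)\<^sup>2 + B * of_int (a * c) + C * (of_int c)\<^sup>2"
      and "B' = 2 * A * of_int (a * b) + B * of_int (a * d + b * c) + 2 * C * of_int (c * d)"
      and "C' = A * (of_int b)\<^sup>2 + B * of_int (b * d) + C * (of_int d)\<^sup>2"
    have f: "qform A B C (act M w) = qform A' B' C' w" if "Im w > 0" for w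
      using qform_act[of a b c d w] M(1) that unfolding M' A'_def B'_def C'_def by blast
    have "B'\<^sup>2 - 4 * A' * C' = (B\<^sup>2 - 4 * A * C) * (of_int (a * d - b * c))\<^sup>2"
      by (simp add: A'_def B'_def C'_def power2_eq_square algebra_simps)
    moreover have "(real_of_int (a * d - b * c))\<^sup>2 = 1"
      using dt by (auto simp del: of_int_diff of_int_mult)
    ultimately have D': "B'\<^sup>2 - 4 * A' * C' > 0" using D by simp
    have "qform A' B' C' z = 0" using f[OF imz] eq q M(2) by simp
    then have e: "A' * ((Re z)\<^sup>2 + (Im z)\<^sup>2) + B' * Re z + C' = 0" using imz by (simp add: qform_def cmod_power2)
    have "\<exists>x. A' * (x\<^sup>2 + 1) + B' * x + C' = 0"
    proof (cases "A' = 0")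
      case True
      then have "B' \<noteq> 0" using D' by auto
      then show ?thesis using True by (intro exI[of _ "- C' / B'"]) simp
    next
      case A0: False
      \<comment> \<open>The circle reaches height \<open>Im z > 1\<close>, so its radius exceeds 1
        and the quadratic for its real parts at height 1 has nonnegative discriminant.\<close>
      have "(2 * A' * Re z + B')\<^sup>2 = 4 * A' * (A' * ((Re z)\<^sup>2 + (Im z)\<^sup>2) + B' * Re z + C') +
          (B'\<^sup>2 - 4 * A' * C' - 4 * A'\<^sup>2 * (Im z)\<^sup>2)"
        by (simp add: power2_eq_square algebra_simps)
      then have "B'\<^sup>2 - 4 * A' * C' - 4 * A'\<^sup>2 * (Im z)\<^sup>2 \<ge> 0"
        using zero_le_power2[of "2 * A' * Re z + B'"] unfolding e by simp
      moreover have "4 * A'\<^sup>2 * 1 \<le> 4 * A'\<^sup>2 * (Im z)\<^sup>2" using y1 by (intro mult_left_mono one_le_power) auto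
      ultimately have "discrim A' B' (A' + C') \<ge> 0" by (simp add: discrim_def power2_eq_square algebra_simps)
      then obtain x where "A' * x\<^sup>2 + B' * x + (A' + C') = 0" using discriminant_nonneg_ex[OF A0] by blast
      then show ?thesis by (intro exI[of _ x]) (simp add: algebra_simps)
    qed
    then obtain x where x: "A' * (x\<^sup>2 + 1) + B' * x + C' = 0" by blast
    define w where "w = Complex x 1"
    have imw: "Im w > 0" by (simp add: w_def)
    have "qform A' B' C' w = 0" using x by (simp add: w_def qform_def cmod_power2)
    then have "qform A B C (act M w) = 0" using f[OF imw] by simp
    moreover have "Im (act M w) > 0" by (rule Im_act_pos(2)[OF M(1) imw])
    ultimately have S: "(act M w, act M w) \<in> geodesic \<alpha> \<beta>" using eq by blast
    have rel: "orbit_rel (act M w) w" by (rule orbit_rel_sym[OF _ imw]) (use M(1) in \<open>auto simp: orbit_rel_def\<close>)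
    \<comment> \<open>Translation brings the real part into [0, 1), within 1/2 of the centre of the
      disc.\<close>
    define v where "v = w + of_int (- \<lfloor>x\<rfloor>)"
    have rv: "orbit_rel (act M w) v" unfolding v_def
      by (rule orbit_rel_trans[OF rel orbit_rel_translate]) (rule Im_act_pos(2)[OF M(1) imw])
    have v: "Re v = frac x" "Im v = 1" by (simp_all add: v_def w_def frac_def)
    have "\<bar>frac x - 1/2\<bar> \<le> \<bar>1/2\<bar>" using frac_ge_0[of x] frac_lt_1[of x] by linarith
    then have "(frac x - 1/2)\<^sup>2 \<le> (1/2)\<^sup>2" by (simp only: abs_le_square_iff)
    then have "rho_form v \<le> 2" by (subst rho_form_le_iff) (simp_all add: v power2_eq_square)
    then show ?thesis using billiard_point_of_orbit[OF S rv] by (meson order_trans)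
  qed
qed

section \<open>Values of billiards\<close>

lemma billiard_points_Im_pos: "p \<in> billiard_points (billiard (geodesic \<alpha> \<beta>)) \<Longrightarrow> Im p > 0"
  by (auto simp: billiard_points_iff fund_triangle_def upper_half_plane_def)

text \<open>A real infimum is meaningful only for a nonempty set bounded below;
  \<open>billiard_meets_disc\<close> supplies the first, nonnegativity of distances the
  second.\<close>

lemma billiard_dist_rho:
  shows "p \<in> billiard_points (billiard (geodesic \<alpha> \<beta>)) \<Longrightarrow>
      billiard_dist rho (billiard (geodesic \<alpha> \<beta>)) \<le> hyp_dist p rho"
    and "\<alpha> \<noteq> \<beta> \<Longrightarrow> (\<And>p. p \<in> billiard_points (billiard (geodesic \<alpha> \<beta>)) \<Longrightarrow> l \<le> hyp_dist p rho) \<Longrightarrow>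
      l \<le> billiard_dist rho (billiard (geodesic \<alpha> \<beta>))"
proof -
  let ?P = "billiard_points (billiard (geodesic \<alpha> \<beta>))"
  note im = billiard_points_Im_pos[of _ \<alpha> \<beta>]
  have "bdd_below ((\<lambda>p. hyp_dist p rho) ` ?P)"
    by (rule bdd_belowI2[of _ 0]) (use im sinh_hyp_dist_rho(3) in blast)
  then show "p \<in> ?P \<Longrightarrow> billiard_dist rho (billiard (geodesic \<alpha> \<beta>)) \<le> hyp_dist p rho"
    unfolding billiard_dist_def by (rule cINF_lower)
  show "l \<le> billiard_dist rho (billiard (geodesic \<alpha> \<beta>))"
    if "\<alpha> \<noteq> \<beta>" "\<And>p. p \<in> ?P \<Longrightarrow> l \<le> hyp_dist p rho"
    unfolding billiard_dist_def using billiard_meets_disc[OF that(1)] that(2) by (intro cINF_greatest) auto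
qed

lemma sinh_billiard_dist_le:
  assumes "\<alpha> \<noteq> \<beta>" "p \<in> billiard_points (billiard (geodesic \<alpha> \<beta>))"
  shows "(sinh (billiard_dist rho (billiard (geodesic \<alpha> \<beta>))))\<^sup>2 \<le> (rho_form p)\<^sup>2 / 3 - 1"
    and "sinh (billiard_dist rho (billiard (geodesic \<alpha> \<beta>))) \<ge> 0"
proof -
  note im = billiard_points_Im_pos[of _ \<alpha> \<beta>]
  have "billiard_dist rho (billiard (geodesic \<alpha> \<beta>)) \<ge> 0"
    using assms(1) sinh_hyp_dist_rho(3) im by (intro billiard_dist_rho(2)) auto
  then show nn: "sinh (billiard_dist rho (billiard (geodesic \<alpha> \<beta>))) \<ge> 0" by simp
  have "sinh (billiard_dist rho (billiard (geodesic \<alpha> \<beta>))) \<le> sinh (hyp_dist p rho)"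
    using billiard_dist_rho(1)[OF assms(2)] by simp
  then show "(sinh (billiard_dist rho (billiard (geodesic \<alpha> \<beta>))))\<^sup>2 \<le> (rho_form p)\<^sup>2 / 3 - 1"
    unfolding sinh_hyp_dist_rho(1)[OF im[OF assms(2)], symmetric] using nn by (intro power_mono) auto
qed

text \<open>By sinh^2 = \<open>rho_form\<close>^2 / 3 - 1, the bound 2 on the form becomes sinh
  \<le> 1 / sqrt 3.\<close>

lemma billiard_value_ge:
  assumes "\<alpha> \<noteq> \<beta>" "p \<in> billiard_points (billiard (geodesic \<alpha> \<beta>))" "rho_form p \<le> 2"
  shows "billiard_value rho (billiard (geodesic \<alpha> \<beta>)) \<ge> ereal (sqrt 3)"
    and "rho_form p < 2 \<Longrightarrow> billiard_value rho (billiard (geodesic \<alpha> \<beta>)) > ereal (sqrt 3)"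
proof -
  define x where "x = sinh (billiard_dist rho (billiard (geodesic \<alpha> \<beta>)))"
  have x: "x\<^sup>2 \<le> (rho_form p)\<^sup>2 / 3 - 1" "x \<ge> 0"
    using sinh_billiard_dist_le[OF assms(1,2)] by (simp_all add: x_def)
  have v: "billiard_value rho (billiard (geodesic \<alpha> \<beta>)) = inverse (ereal x)"
    by (simp add: billiard_value_def x_def)
  have im: "Im p > 0" using assms(2) by (rule billiard_points_Im_pos)
  have f: "rho_form p \<ge> 0"
    using cosh_hyp_dist_rho[OF im] cosh_real_pos[of "hyp_dist p rho"] by (simp add: zero_less_divide_iff)
  have "(rho_form p)\<^sup>2 \<le> 2\<^sup>2" using assms(3) f by (rule power_mono)
  then have "(sqrt 3 * x)\<^sup>2 \<le> 1\<^sup>2" using x(1) by (simp add: power_mult_distrib)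
  then have "sqrt 3 * x \<le> 1" by (rule power2_le_imp_le) simp
  \<comment> \<open>For \<open>x = 0\<close> the value is infinite and the bound is trivial.\<close>
  then show "billiard_value rho (billiard (geodesic \<alpha> \<beta>)) \<ge> ereal (sqrt 3)"
    unfolding v using x(2) by (cases "x = 0") (auto simp: field_simps)
  assume "rho_form p < 2"
  then have "(rho_form p)\<^sup>2 < 2\<^sup>2" using f by (intro power_strict_mono) auto
  then have "(sqrt 3 * x)\<^sup>2 < 1\<^sup>2" using x(1) by (simp add: power_mult_distrib)
  then have "sqrt 3 * x < 1" by (rule power_less_imp_less_base) simp
  then show "billiard_value rho (billiard (geodesic \<alpha> \<beta>)) > ereal (sqrt 3)"
    unfolding v using x(2) by (cases "x = 0") (auto simp: field_simps)
qed

text \<open>The hypothesis says that sinh of the distance is at least \<open>s\<close> on the whole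
  orbit; \<open>arsinh s\<close> carries this bound through the infimum.\<close>

lemma billiard_value_le:
  assumes "\<alpha> \<noteq> \<beta>" "s > 0"
    and "\<And>q M. (q, q) \<in> geodesic \<alpha> \<beta> \<Longrightarrow> M \<in> GL2Z \<Longrightarrow> (rho_form (act M q))\<^sup>2 \<ge> 3 * (1 + s\<^sup>2)"
  shows "billiard_value rho (billiard (geodesic \<alpha> \<beta>)) \<le> ereal (1 / s)"
proof -
  have "arsinh s \<le> hyp_dist p rho" if "p \<in> billiard_points (billiard (geodesic \<alpha> \<beta>))" for p
  proof -
    have im: "Im p > 0" using that by (rule billiard_points_Im_pos)
    have "(rho_form p)\<^sup>2 \<ge> 3 * (1 + s\<^sup>2)" using that assms(3) by (auto simp: billiard_points_iff)
    then have "s\<^sup>2 \<le> (sinh (hyp_dist p rho))\<^sup>2" by (simp add: sinh_hyp_dist_rho(1)[OF im])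
    then have "s \<le> sinh (hyp_dist p rho)" by (rule power2_le_imp_le) (rule sinh_hyp_dist_rho(2)[OF im])
    then have "sinh (arsinh s) \<le> sinh (hyp_dist p rho)" by simp
    then show ?thesis by (simp only: sinh_real_le_iff)
  qed
  then have "arsinh s \<le> billiard_dist rho (billiard (geodesic \<alpha> \<beta>))"
    by (rule billiard_dist_rho(2)[OF assms(1)])
  moreover define x where "x = sinh (billiard_dist rho (billiard (geodesic \<alpha> \<beta>)))"
  ultimately have "s \<le> x"
    by (metis sinh_arsinh_real sinh_real_le_iff)
  then show ?thesis using assms(2) unfolding billiard_value_def x_def[symmetric]
    by (simp add: field_simps)
qed

section \<open>Lower bounds for the form of \<open>rho\<close> along vertical geodesics\<close>

text \<open>Modulo 2, \<open>B\<close> is odd. For positive \<open>B\<close> the sum exceeds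
  \<open>N\<close>. For \<open>B = 1 - 2 * k\<close>, failure would trap \<open>A\<close> between
  N(k - 1) and N k, which is incompatible with A C = k(k - 1) + 1.\<close>

lemma abs_form_value_ge:
  fixes A B C N :: int
  assumes AC: "4 * A * C = B\<^sup>2 + 3" and "A \<ge> 1" "C \<ge> 1" "N \<ge> 2"
  shows "\<bar>2 * A + B * N\<bar> \<ge> N - 2"
proof -
  have odd: "odd B"
  proof
    assume "even B"
    then have "even (B\<^sup>2)" "even (B\<^sup>2 + 3)" using AC by (simp_all flip: AC)
    then show False by simp
  qed
  show ?thesis
  proof (cases "B \<ge> 0")
    case True
    have "B \<ge> 1" using True odd by (cases "B = 0") auto
    then have "1 * N \<le> B * N" using assms by (intro mult_right_mono) auto
    then show ?thesis using assms abs_ge_self[of "2 * A + B * N"] by linarith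
  next
    case False
    have "odd (- B)" using odd by simp
    then obtain j where j: "- B = 2 * j + 1" by (elim oddE)
    define k where "k = j + 1"
    have B: "B = 1 - 2 * k" using j by (simp add: k_def)
    have k: "k \<ge> 1" using False B by linarith
    have ac: "A * C = k * (k - 1) + 1" using AC unfolding B by (simp add: power2_eq_square algebra_simps)
    show ?thesis
    proof (rule ccontr)
      assume "\<not> ?thesis"
      \<comment> \<open>Both inequalities are strict between integers, so after halving they leave a
        margin of 2 at each end for \<open>A\<close>.\<close>
      then have "2 * A + B * N < N - 2" "- (N - 2) < 2 * A + B * N" by linarith+
      then have u: "A \<le> N * k - 2" and l: "N * (k - 1) + 2 \<le> A"
        unfolding B by (simp_all add: algebra_simps)
      show False
      \<comment> \<open>Multiplied by \<open>C\<close>, the lower bound on \<open>A\<close> makes A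
        C too large in the first case, and the upper bound makes it too small in the second.\<close>
      proof (cases "k \<le> C * N")
        case True
        have "(N * (k - 1) + 2) * C \<le> A * C" using l assms by (intro mult_right_mono) auto
        moreover have "k * (k - 1) \<le> (C * N) * (k - 1)" using True k by (intro mult_right_mono) auto
        moreover have "(N * (k - 1) + 2) * C = (C * N) * (k - 1) + 2 * C" by (simp add: algebra_simps)
        ultimately show False using ac assms by linarith
      next
        case False
        have "A * C \<le> (N * k - 2) * C" using u assms by (intro mult_right_mono) auto
        moreover have "(C * N) * k \<le> (k - 1) * k" using False k by (intro mult_right_mono) auto
        moreover have "(N * k - 2) * C = (C * N) * k - 2 * C" by (simp add: algebra_simps)
        ultimately show False using ac assms by (simp add: mult.commute)
      qed
    qed
  qed
qed

lemma C0_rho_form_ge: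
  assumes "(q, q) \<in> geodesic (Fin 0) Infty" "M \<in> GL2Z"
  shows "(rho_form (act M q))\<^sup>2 \<ge> 4"
proof -
  obtain A B C :: int where AC: "4 * A * C = B\<^sup>2 + 3" "A \<ge> 1" "C \<ge> 1"
    and f: "\<And>z. Im z > 0 \<Longrightarrow> rho_form (act M z) = qform (of_int A) (of_int B) (of_int C) z"
    by (rule rho_form_act[OF assms(2)]) (rule that)
  have q: "Im q > 0" "Re q = 0" using assms(1) by (auto simp: upper_half_plane_def)
  have "4 * (A * C) = B\<^sup>2 + 3" using AC(1) by (simp only: mult.assoc)
  then have "A * C > 0" using zero_le_power2[of B] by linarith
  then have "4 \<le> 4 * A * C" by simp
  then have "(4::real) \<le> of_int (4 * A * C)" by linarith
  also have "\<dots> \<le> (qform (of_int A) (of_int B) (of_int C) q)\<^sup>2"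
    using qform_vertical_ge[of "of_int A" q "of_int B" "of_int C"] AC(2) q by simp
  finally show ?thesis by (simp add: f q)
qed

text \<open>At real part 1/N the bound of \<open>qform_vertical_ge\<close> equals 3 + ((2 A + B N) /
  N)^2 because 4 A C - B^2 = 3, and \<open>abs_form_value_ge\<close> bounds the square.\<close>

lemma near_imaginary_axis_rho_form_ge:
  fixes N :: int
  assumes "N \<ge> 2" "(q, q) \<in> geodesic (Fin (1 / of_int N)) Infty" "M \<in> GL2Z"
  shows "(rho_form (act M q))\<^sup>2 \<ge> 3 + ((of_int N - 2) / of_int N)\<^sup>2"
proof -
  obtain A B C :: int where AC: "4 * A * C = B\<^sup>2 + 3" "A \<ge> 1" "C \<ge> 1"
    and f: "\<And>z. Im z > 0 \<Longrightarrow> rho_form (act M z) = qform (of_int A) (of_int B) (of_int C) z"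
    by (rule rho_form_act[OF assms(3)]) (rule that)
  have q: "Im q > 0" "Re q = 1 / of_int N" using assms(2) by (auto simp: upper_half_plane_def)
  have AC': "4 * real_of_int A * of_int C = (of_int B)\<^sup>2 + 3"
    using arg_cong[OF AC(1), of real_of_int] by simp
  have N: "real_of_int N \<ge> 2" using assms(1) by simp
  have "\<bar>2 * A + B * N\<bar> \<ge> \<bar>N - 2\<bar>" using abs_form_value_ge[OF AC assms(1)] assms(1) by simp
  then have "(N - 2)\<^sup>2 \<le> (2 * A + B * N)\<^sup>2" by (simp only: abs_le_square_iff)
  then have "real_of_int ((N - 2)\<^sup>2) \<le> of_int ((2 * A + B * N)\<^sup>2)" by (simp only: of_int_le_iff)
  then have "(real_of_int N - 2)\<^sup>2 / (of_int N)\<^sup>2 \<le> (2 * of_int A + of_int B * of_int N)\<^sup>2 / (of_int N)\<^sup>2"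
    by (intro divide_right_mono) auto
  also have "\<dots> = 4 * of_int A * (of_int A * (Re q)\<^sup>2 + of_int B * Re q) + (of_int B)\<^sup>2"
    using N by (simp add: q(2) power2_eq_square field_simps)
  also have "\<dots> = 4 * of_int A * (of_int A * (Re q)\<^sup>2 + of_int B * Re q + of_int C) - 3"
    using AC' by (simp add: algebra_simps)
  also have "\<dots> \<le> (qform (of_int A) (of_int B) (of_int C) q)\<^sup>2 - 3"
    using qform_vertical_ge[of "of_int A" q "of_int B" "of_int C"] AC(2) q(1) by simp
  finally show ?thesis by (simp add: f q(1) power_divide)
qed

section \<open>Values accumulating at \<open>sqrt 3\<close>\<close>

lemma near_imaginary_axis_value:
  fixes n :: nat
  defines "B \<equiv> billiard (geodesic (Fin (1 / real (n + 3))) Infty)"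
  shows "ereal (sqrt 3) < billiard_value rho B"
    and "billiard_value rho B \<le> ereal (sqrt 3 * (1 + 2 * inverse (real (Suc n))))"
proof -
  \<comment> \<open>At height 1 the form is 2 - x + x^2, which is below 2 for 0 < x < 1; hence the
    strict inequality.\<close>
  define z where "z = Complex (1 / real (n + 3)) 1"
  have "1 / real (n + 3) > 0" "1 / real (n + 3) < 1" by simp_all
  then have "(1 / real (n + 3))\<^sup>2 < 1 / real (n + 3)" unfolding power2_eq_square
    using mult_strict_left_mono[of "1 / real (n + 3)" 1 "1 / real (n + 3)"] by simp
  then have z2: "rho_form z < 2" by (simp add: rho_form_def qform_def z_def cmod_power2)
  have zS: "(z, z) \<in> geodesic (Fin (1 / real (n + 3))) Infty" by (simp add: z_def upper_half_plane_def)
  obtain p where p: "p \<in> billiard_points B" "rho_form p \<le> rho_form z"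
    using billiard_point_of_orbit[OF zS orbit_rel_refl] unfolding B_def by blast
  then have "rho_form p < 2" using z2 by linarith
  then show "ereal (sqrt 3) < billiard_value rho B"
    using p(1) unfolding B_def by (intro billiard_value_ge(2)[of _ _ p]) simp_all
  \<comment> \<open>With N = n + 3 this is (N - 2) / (sqrt 3 N), so that 3(1 + s^2) is the bound
    just proved; N \<ge> 3 keeps it positive.\<close>
  define s where "s = real (n + 1) / (sqrt 3 * real (n + 3))"
  have s2: "3 * (1 + s\<^sup>2) = 3 + ((real_of_int (int n + 3) - 2) / real_of_int (int n + 3))\<^sup>2"
    by (simp add: s_def power_divide power_mult_distrib)
  have "billiard_value rho B \<le> ereal (1 / s)"
    unfolding B_def
  proof (rule billiard_value_le)
    show "s > 0" by (simp add: s_def)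
    show "(rho_form (act M q))\<^sup>2 \<ge> 3 * (1 + s\<^sup>2)"
      if "(q, q) \<in> geodesic (Fin (1 / real (n + 3))) Infty" "M \<in> GL2Z" for q M
      unfolding s2 by (rule near_imaginary_axis_rho_form_ge) (use that in simp_all)
  qed simp
  also have "1 / s = sqrt 3 * (1 + 2 * inverse (real (Suc n)))"
    by (simp add: s_def field_simps)
  finally show "billiard_value rho B \<le> ereal (sqrt 3 * (1 + 2 * inverse (real (Suc n))))" .
qed

lemma billiard_in_modular_billiards:
  "\<alpha> \<noteq> \<beta> \<Longrightarrow> billiard (geodesic \<alpha> \<beta>) \<in> modular_billiards"
  unfolding modular_billiards_def oriented_geodesics_def by blast

text \<open>The values along this sequence stay strictly above \<open>sqrt 3\<close> and are
  squeezed towards it.\<close>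

lemma sqrt3_islimpt_value_set: "ereal (sqrt 3) islimpt value_set rho"
proof -
  define f where "f n = billiard_value rho (billiard (geodesic (Fin (1 / real (n + 3))) Infty))" for n :: nat
  have bounds: "ereal (sqrt 3) \<le> f n" "f n \<le> ereal (sqrt 3 * (1 + 2 * inverse (real (Suc n))))" for n
    unfolding f_def using near_imaginary_axis_value by (blast intro: less_imp_le)+
  have "f n \<in> value_set rho - {ereal (sqrt 3)}" for n
  proof (intro DiffI)
    show "f n \<in> value_set rho"
      unfolding f_def value_set_def by (intro imageI billiard_in_modular_billiards) simp
    show "f n \<notin> {ereal (sqrt 3)}"
      using near_imaginary_axis_value(1)[of n] unfolding f_def by (simp only: singleton_iff)
  qed
  moreover have "f \<longlonglongrightarrow> ereal (sqrt 3)"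
  proof (rule tendsto_sandwich[OF _ _ tendsto_const])
    have "(\<lambda>n. sqrt 3 * (1 + 2 * inverse (real (Suc n)))) \<longlonglongrightarrow> sqrt 3 * (1 + 2 * 0)"
      by (intro tendsto_intros LIMSEQ_inverse_real_of_nat)
    then show "(\<lambda>n. ereal (sqrt 3 * (1 + 2 * inverse (real (Suc n))))) \<longlonglongrightarrow> ereal (sqrt 3)"
      by simp
  qed (use bounds in \<open>simp_all only: eventually_True\<close>)
  ultimately show ?thesis unfolding islimpt_sequential by blast
qed

theorem theorem1p2:
  "C0 \<in> modular_billiards \<and> billiard_value rho C0 = ereal (sqrt 3) \<and>
   (\<forall>B\<in>modular_billiards. billiard_value rho B \<ge> ereal (sqrt 3)) \<and>
   ereal (sqrt 3) islimpt value_set rho"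
proof (intro conjI ballI)
  show C0: "C0 \<in> modular_billiards"
    unfolding C0_def by (rule billiard_in_modular_billiards) simp
  show ge: "ereal (sqrt 3) \<le> billiard_value rho B" if "B \<in> modular_billiards" for B
  proof -
    obtain \<alpha> \<beta> where "\<alpha> \<noteq> \<beta>" "B = billiard (geodesic \<alpha> \<beta>)"
      using \<open>B \<in> modular_billiards\<close> unfolding modular_billiards_def oriented_geodesics_def by blast
    then show ?thesis using billiard_meets_disc billiard_value_ge(1) by blast
  qed
  \<comment> \<open>The choice \<open>s = 1 / sqrt 3\<close> turns 3(1 + s^2) into 4, the bound on
    the imaginary axis.\<close>
  have "billiard_value rho C0 \<le> ereal (1 / (1 / sqrt 3))"
    unfolding C0_def by (rule billiard_value_le) (use C0_rho_form_ge in \<open>auto simp: power_divide\<close>)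
  then show "billiard_value rho C0 = ereal (sqrt 3)" using ge[OF C0] by (intro antisym) auto
qed (rule sqrt3_islimpt_value_set)

end
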